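(* Let the Pick matrix $P$ of an interpolation data set be invertible, let $\varphi\in\widetilde{\mathbf{N}}_0$, let $w=\mathbf{T}_\Theta[\varphi]$, and let $x_i$ be an interpolation node with $i\in\{1,\dots,\ell\}$. Suppose that $\tilde e_i=0$. Then: 1. The nontangential boundary limits $w'(x_i)$ and $w(x_i)$ exist and satisfy $w'(x_i)=\gamma_i$ and $w(x_i)=w_i$ if and only if $\varphi$ meets either condition $\widetilde{\mathbf C}_1$ or $\widetilde{\mathbf C}_2$ at $x_i$. 2. The nontangential boundary limits $w'(x_i)$ and $w(x_i)$ exist and satisfy $-\infty<w'(x_i)<\gamma_i$ and $w(x_i)=w_i$ if and only if $\varphi$ meets condition $\widetilde{\mathbf C}_3$ at $x_i$. 3. The nontangential boundary limits $w'(x_i)$ and $w(x_i)$ exist and satisfy $\gamma_i<w'(x_i)<\infty$ and $w(x_i)=w_i$ if and only if $\varphi$ meets condition $\widetilde{\mathbf C}_4$ at $x_i$. 4. If $\varphi$ meets condition $\widetilde{\mathbf C}_5$ at $x_i$, then one of the following holds: (a) the nontangential boundary limit $w(x_i)$ fails to exist; (b) the limit $w(x_i)$ exists and $w(x_i)\ne w_i$; (c) $w(x_i)=w_i$ and $|K_w(x_i,x_i)|=\infty$. 5. If $\varphi$ meets condition $\widetilde{\mathbf C}_6$ at $x_i$, then the nontangential boundary limit $w(x_i)$ exists and $w(x_i)\ne w_i$.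
   Context: Classes. $\mathbb{C}^+$ is the open upper half plane. For $f$ meromorphic on $\mathbb{C}^+$, $K_f(z,\zeta)=\frac{f(z)-\overline{f(\zeta)}}{z-\bar\zeta}$. $\mathbf{N}_0$ is the Nevanlinna class (functions analytic on $\mathbb{C}^+$ with nonnegative imaginary part) and $\widetilde{\mathbf{N}}_0=\mathbf{N}_0\cup\{\infty\}$, where $\infty$ is the function identically $\infty$. Boundary limits. For $x\in\mathbb{R}$, $f(x)$, $f'(x)$, $f_{-1}(x)$ and $K_f(x,x)$ denote the nontangential limits as $z\to x$ of $f(z)$, $f'(z)$, $(z-x)f(z)$ and $K_f(z,z)$, when they exist (the limit $f(x)$ may be $\infty$). If $f\equiv\infty$, then $f_{-1}(x)=\infty$; $1/\infty=0$. Data. $x_1,\dots,x_n$ are distinct real numbers (nodes), $0\le\ell\le n$, $w_j,\gamma_j\in\mathbb{R}$ $(1\le j\le\ell)$, $\xi_k\in\mathbb{R}\setminus\{0\}$ $(\ell<k\le n)$. The Pick matrix $P=[p_{ij}]_{i,j=1}^n$ is the real symmetric matrix with: $p_{ij}=\frac{w_j-w_i}{x_j-x_i}$ for $i\ne j$ and $p_{ii}=\gamma_i$, for $i,j\le\ell$; $p_{ij}=p_{ji}=\frac{\xi_j}{x_j-x_i}$ for $i\le\ell<j$; $p_{ii}=-\xi_i$ and $p_{ij}=0$ $(i\neq j)$ for $i,j>\ell$. Also $X=\mathrm{diag}(x_1,\dots,x_n)$, $C=[w_1\ \cdots\ w_\ell\ \xi_{\ell+1}\ \cdots\ \xi_n]$,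 $E=[1\ \cdots\ 1\ 0\ \cdots\ 0]$ ($\ell$ ones), $J=\begin{bmatrix}0&-i\\ i&0\end{bmatrix}$. For $P$ invertible, $\Theta(z)=[\Theta_{ij}(z)]_{i,j=1}^2=I_2-i\begin{bmatrix}C\\ E\end{bmatrix}(zI-X)^{-1}P^{-1}\begin{bmatrix}C^*&E^*\end{bmatrix}J$ and $\mathbf{T}_\Theta[\varphi]=\frac{\Theta_{11}\varphi+\Theta_{12}}{\Theta_{21}\varphi+\Theta_{22}}$, with $\mathbf{T}_\Theta[\infty]=\Theta_{11}/\Theta_{21}$ ($\mathbf{T}_\Theta[\varphi]\equiv\infty$ if the denominator vanishes identically). Let $\tilde c_i$, $\tilde e_i$ be the $i$-th entries of the row vectors $CP^{-1}$, $EP^{-1}$ (real, not both zero), and $\tilde p_{ii}$ the $i$-th diagonal entry of $P^{-1}$. Conditions on $\varphi\in\widetilde{\mathbf{N}}_0$ at $x_i$ when $\tilde e_i=0$ (exactly one holds): $\widetilde{\mathbf C}_1$: it is not the case that the limit $\varphi(x_i)$ exists and equals $\infty$. $\widetilde{\mathbf C}_2$: $\varphi(x_i)=\infty$ and $\varphi_{-1}(x_i)=0$. $\widetilde{\mathbf C}_3$: $\varphi(x_i)=\infty$ and $-\tilde p_{ii}/\tilde c_i^2<-1/\varphi_{-1}(x_i)<\infty$. $\widetilde{\mathbf C}_4$: $\varphi(x_i)=\infty$ and $0\le-1/\varphi_{-1}(x_i)<-\tilde p_{ii}/\tilde c_i^2$. $\widetilde{\mathbf C}_5$: $\varphi(x_i)=\infty$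 and $1/\varphi_{-1}(x_i)=\tilde p_{ii}/\tilde c_i^2<0$. $\widetilde{\mathbf C}_6$: $\varphi(x_i)=\infty$ and $1/\varphi_{-1}(x_i)=\tilde p_{ii}=0$. *)

theory Defs
  imports "HOL-Analysis.Analysis"
begin

text \<open>
  \<open>Fin f\<close> is a function on the upper half plane (only its values there matter), and
  \<open>Infty\<close> is the function identically \<open>\<infinity>\<close>. The same type is used for boundary values.
  In \<open>Fin f\<close> with \<open>f\<close> meromorphic, the value of \<open>f\<close> at a pole is arbitrary.
\<close>

datatype 'a with_infty = Fin 'a | Infty

definition upper_half_plane :: "complex set" where
  "upper_half_plane = {z. 0 < Im z}"

definition nevanlinna :: "(complex \<Rightarrow> complex) \<Rightarrow> bool" where
  "nevanlinna f \<longleftrightarrow>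
     f holomorphic_on upper_half_plane \<and> (\<forall>z\<in>upper_half_plane. 0 \<le> Im (f z))"

definition nevanlinna_ext :: "(complex \<Rightarrow> complex) with_infty set" where
  "nevanlinna_ext = insert Infty (Fin ` {f. nevanlinna f})"

definition kernel :: "(complex \<Rightarrow> complex) \<Rightarrow> complex \<Rightarrow> complex \<Rightarrow> complex" where
  "kernel f z \<zeta> = (f z - cnj (f \<zeta>)) / (z - cnj \<zeta>)"

section \<open>Nontangential boundary limits\<close>

definition stolz_angle :: "real \<Rightarrow> real \<Rightarrow> complex set" where
  "stolz_angle x M = {z \<in> upper_half_plane. \<bar>Re z - x\<bar> \<le> M * Im z}"

text \<open>Convergence along this filter is convergence within every Stolz angle at \<open>x\<close>.\<close>

definition at_nontangential :: "real \<Rightarrow> complex filter" where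
  "at_nontangential x = (SUP M\<in>{0<..}. at (complex_of_real x) within stolz_angle x M)"

fun has_boundary_value ::
  "(complex \<Rightarrow> complex) with_infty \<Rightarrow> real \<Rightarrow> complex with_infty \<Rightarrow> bool" where
  "has_boundary_value (Fin f) x (Fin c) \<longleftrightarrow> (f \<longlongrightarrow> c) (at_nontangential x)"
| "has_boundary_value (Fin f) x Infty \<longleftrightarrow> filterlim f at_infinity (at_nontangential x)"
| "has_boundary_value Infty x v \<longleftrightarrow> v = Infty"

fun has_boundary_deriv :: "(complex \<Rightarrow> complex) with_infty \<Rightarrow> real \<Rightarrow> complex \<Rightarrow> bool" where
  "has_boundary_deriv (Fin f) x d \<longleftrightarrow> (deriv f \<longlongrightarrow> d) (at_nontangential x)"
| "has_boundary_deriv Infty x d \<longleftrightarrow> False"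

text \<open>\<open>|K\<^sub>f(x, x)| = \<infinity>\<close>; the kernel of the function identically \<open>\<infinity>\<close> is undefined.\<close>

fun boundary_kernel_infinite :: "(complex \<Rightarrow> complex) with_infty \<Rightarrow> real \<Rightarrow> bool" where
  "boundary_kernel_infinite (Fin f) x \<longleftrightarrow>
     filterlim (\<lambda>z. norm (kernel f z z)) at_top (at_nontangential x)"
| "boundary_kernel_infinite Infty x \<longleftrightarrow> False"

text \<open>
  The limit \<open>f\<^sub>-\<^sub>1(x)\<close> of \<open>(z - x) f z\<close>. It is only used for functions in
  \<open>nevanlinna_ext\<close>, where it is always real or \<open>\<infinity>\<close>.
\<close>

fun has_boundary_residue :: "(complex \<Rightarrow> complex) with_infty \<Rightarrow> real \<Rightarrow> ereal \<Rightarrow> bool" where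
  "has_boundary_residue (Fin f) x m \<longleftrightarrow>
     (\<exists>r. m = ereal r \<and>
        ((\<lambda>z. (z - of_real x) * f z) \<longlongrightarrow> of_real r) (at_nontangential x)) \<or>
     (m = \<infinity> \<and> filterlim (\<lambda>z. (z - of_real x) * f z) at_infinity (at_nontangential x))"
| "has_boundary_residue Infty x m \<longleftrightarrow> m = \<infinity>"

section \<open>The interpolation data and its Pick matrix\<close>

text \<open>
  The nodes are indexed by a finite type; \<open>L\<close> is the set of indices written
  \<open>{1, \<dots>, l}\<close> when the nodes are enumerated with these indices first. The numbers \<open>w i\<close>
  and \<open>\<gamma> i\<close> matter only for \<open>i \<in> L\<close>, and \<open>\<xi> i\<close> only for \<open>i \<notin> L\<close>.
\<close>

definition interpolation_data :: "'n::finite set \<Rightarrow> ('n \<Rightarrow> real) \<Rightarrow> ('n \<Rightarrow> real) \<Rightarrow> bool" where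
  "interpolation_data L x \<xi> \<longleftrightarrow> inj x \<and> (\<forall>k. k \<notin> L \<longrightarrow> \<xi> k \<noteq> 0)"

definition pick_matrix ::
  "'n::finite set \<Rightarrow> ('n \<Rightarrow> real) \<Rightarrow> ('n \<Rightarrow> real) \<Rightarrow> ('n \<Rightarrow> real) \<Rightarrow> ('n \<Rightarrow> real) \<Rightarrow> real^'n^'n" where
  "pick_matrix L x w \<gamma> \<xi> = (\<chi> i j.
     if i \<in> L \<and> j \<in> L then (if i = j then \<gamma> i else (w j - w i) / (x j - x i))
     else if i \<in> L \<and> j \<notin> L then \<xi> j / (x j - x i)
     else if i \<notin> L \<and> j \<in> L then \<xi> i / (x i - x j)
     else (if i = j then - \<xi> i else 0))"

definition C_row :: "'n::finite set \<Rightarrow> ('n \<Rightarrow> real) \<Rightarrow> ('n \<Rightarrow> real) \<Rightarrow> real^'n" where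
  "C_row L w \<xi> = (\<chi> j. if j \<in> L then w j else \<xi> j)"

definition E_row :: "'n::finite set \<Rightarrow> real^'n" where
  "E_row L = (\<chi> j. if j \<in> L then 1 else 0)"

definition complex_matrix :: "real^'n^'m \<Rightarrow> complex^'n^'m" where
  "complex_matrix A = (\<chi> i j. complex_of_real (A $ i $ j))"

definition node_matrix :: "('n::finite \<Rightarrow> real) \<Rightarrow> real^'n^'n" where
  "node_matrix x = (\<chi> i j. if i = j then x i else 0)"

definition J_matrix :: "complex^2^2" where
  "J_matrix = vector [vector [0, - \<i>], vector [\<i>, 0]]"

text \<open>Adjoints are transposes here, because \<open>C\<close> and \<open>E\<close> are real.\<close>

definition Theta ::
  "'n::finite set \<Rightarrow> ('n \<Rightarrow> real) \<Rightarrow> ('n \<Rightarrow> real) \<Rightarrow> ('n \<Rightarrow> real) \<Rightarrow> ('n \<Rightarrow> real)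
    \<Rightarrow> complex \<Rightarrow> complex^2^2" where
  "Theta L x w \<gamma> \<xi> z =
     (let CE = complex_matrix (vector [C_row L w \<xi>, E_row L] :: real^'n^2)
      in mat 1 - mat \<i> ** (CE ** matrix_inv (mat z - complex_matrix (node_matrix x))
           ** complex_matrix (matrix_inv (pick_matrix L x w \<gamma> \<xi>))
           ** transpose CE ** J_matrix))"

text \<open>
  The numerator and denominator of \<open>T\<^sub>\<Theta>[\<phi>]\<close> have no common zeros in the upper half plane
  when the Pick matrix is invertible (then \<open>\<Theta>\<close> has determinant 1 there), so the zeros of
  the denominator are exactly the poles of the quotient; division by zero gives 0 at these points.
\<close>

fun lin_frac ::
  "(complex \<Rightarrow> complex^2^2) \<Rightarrow> (complex \<Rightarrow> complex) with_infty \<Rightarrow> (complex \<Rightarrow> complex) with_infty" where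
  "lin_frac T (Fin \<phi>) =
     (if \<forall>z\<in>upper_half_plane. T z $ 2 $ 1 * \<phi> z + T z $ 2 $ 2 = 0 then Infty
      else Fin (\<lambda>z. (T z $ 1 $ 1 * \<phi> z + T z $ 1 $ 2) / (T z $ 2 $ 1 * \<phi> z + T z $ 2 $ 2)))"
| "lin_frac T Infty =
     (if \<forall>z\<in>upper_half_plane. T z $ 2 $ 1 = 0 then Infty
      else Fin (\<lambda>z. T z $ 1 $ 1 / T z $ 2 $ 1))"

section \<open>The conditions on the parameter\<close>

text \<open>
  \<open>-1/m\<close> for a boundary residue \<open>m\<close>. The finite boundary residues of Nevanlinna functions are
  \<open>\<le> 0\<close>, hence \<open>-1/0\<close> is read as \<open>+\<infinity>\<close>; and \<open>1/\<infinity> = 0\<close>.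
\<close>

definition neg_recip :: "ereal \<Rightarrow> ereal" where
  "neg_recip m = (if m = 0 then \<infinity> else - (1 / m))"

text \<open>
  In the conditions below, \<open>p\<close> stands for the diagonal entry of \<open>P\<^sup>-\<^sup>1\<close> and \<open>c\<close>
  for the entry of \<open>C P\<^sup>-\<^sup>1\<close> that belong to the node \<open>x\<close>.
\<close>

definition cond1 :: "(complex \<Rightarrow> complex) with_infty \<Rightarrow> real \<Rightarrow> bool" where
  "cond1 \<phi> x \<longleftrightarrow> \<not> has_boundary_value \<phi> x Infty"

definition cond2 :: "(complex \<Rightarrow> complex) with_infty \<Rightarrow> real \<Rightarrow> bool" where
  "cond2 \<phi> x \<longleftrightarrow> has_boundary_value \<phi> x Infty \<and> has_boundary_residue \<phi> x 0"

definition cond3 :: "real \<Rightarrow> real \<Rightarrow> (complex \<Rightarrow> complex) with_infty \<Rightarrow> real \<Rightarrow> bool" where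
  "cond3 p c \<phi> x \<longleftrightarrow> has_boundary_value \<phi> x Infty \<and>
     (\<exists>m. has_boundary_residue \<phi> x m \<and>
        ereal (- p / c\<^sup>2) < neg_recip m \<and> neg_recip m < \<infinity>)"

definition cond4 :: "real \<Rightarrow> real \<Rightarrow> (complex \<Rightarrow> complex) with_infty \<Rightarrow> real \<Rightarrow> bool" where
  "cond4 p c \<phi> x \<longleftrightarrow> has_boundary_value \<phi> x Infty \<and>
     (\<exists>m. has_boundary_residue \<phi> x m \<and>
        0 \<le> neg_recip m \<and> neg_recip m < ereal (- p / c\<^sup>2))"

definition cond5 :: "real \<Rightarrow> real \<Rightarrow> (complex \<Rightarrow> complex) with_infty \<Rightarrow> real \<Rightarrow> bool" where
  "cond5 p c \<phi> x \<longleftrightarrow> has_boundary_value \<phi> x Infty \<and>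
     (\<exists>m. has_boundary_residue \<phi> x m \<and> 1 / m = ereal (p / c\<^sup>2)) \<and> p / c\<^sup>2 < 0"

definition cond6 :: "real \<Rightarrow> (complex \<Rightarrow> complex) with_infty \<Rightarrow> real \<Rightarrow> bool" where
  "cond6 p \<phi> x \<longleftrightarrow> has_boundary_value \<phi> x Infty \<and>
     (\<exists>m. has_boundary_residue \<phi> x m \<and> 1 / m = ereal p) \<and> p = 0"

end

theory Submission
  imports Defs "HOL-Complex_Analysis.Complex_Singularities"
begin

text \<open>
  Write \<open>t = z - x\<^sub>i\<close>. Since \<open>e\<^sub>i = 0\<close>, the quantity \<open>(w - w\<^sub>i)/t\<close> is a linear fractional transform of
  \<open>t \<phi>\<close> whose coefficients are regular at \<open>x\<^sub>i\<close>. For a Nevanlinna function \<open>\<phi>\<close>, Julia's lemma gives a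
  number \<open>m \<ge> 0\<close> with \<open>t \<phi> \<rightarrow> -m\<close> nontangentially, and the Lyapunov identity for \<open>P\<^sup>-\<^sup>1\<close> evaluates the
  coefficients, so that \<open>(w - w\<^sub>i)/t \<rightarrow> \<gamma>\<^sub>i - m/(c\<^sup>2 + p m)\<close>. The conditions on \<open>\<phi>\<close> only record whether \<open>m\<close>
  vanishes and the sign of \<open>c\<^sup>2 + p m\<close>; for \<open>\<phi> = \<infinity>\<close> one lets \<open>m \<rightarrow> \<infinity>\<close>. If \<open>c\<^sup>2 + p m = 0\<close>,
  then near \<open>x\<^sub>i\<close> the function \<open>w - w\<^sub>i\<close> is a linear fractional transform of \<open>\<phi> + m/t\<close>, a function
  without point mass at \<open>x\<^sub>i\<close>, and the Schwarz-Pick inequality forces the kernel to blow up.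
\<close>

section \<open>The Schwarz-Pick inequality in the half plane\<close>

text \<open>The claims are equivalences, so the limits must also be shown to fail outside the listed
  conditions. Write w - w_i = t N / D with N and D affine in t \<phi>. For finite \<phi> their
  limits at the node satisfy D0 = -(c^2 + p m)/c and N0 = \<gamma>_i D0 + m/c, so they never vanish
  together: D0 = 0 forces m > 0 and hence N0 nonzero. A zero of D0 is then a true singularity of (w
  - w_i)/t, incompatible with a convergent derivative. An obstacle is that the value of
  \<open>lin_frac\<close> at a pole is a mere default, so poles near the node must be excluded
  before anything is differentiated. Another is that \<phi> need not have a boundary value; only t
  \<phi> always converges, and the coefficients are arranged so that \<phi> enters through this
  product alone.\<close>

lemma open_upper_half_plane: "open upper_half_plane"
  unfolding upper_half_plane_def by (rule open_halfspace_Im_gt)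

lemma connected_upper_half_plane: "connected upper_half_plane"
  unfolding upper_half_plane_def by (intro convex_connected convex_halfspace_Im_gt)

text \<open>\<open>T\<close> carries the unit disc to the half plane with
  \<open>T 0 = \<zeta>\<close>, and \<open>h\<close> is a Cayley transform of \<open>f (T s)\<close>
  that vanishes at 0. The inequality is the Schwarz lemma for \<open>h\<close> at the preimage
  \<open>s\<close> of \<open>z\<close>.\<close>

lemma schwarz_pick_aux:
  assumes hol: "f holomorphic_on upper_half_plane"
    and pos: "\<And>z. 0 < Im z \<Longrightarrow> 0 < Im (f z)"
    and z: "0 < Im z" and \<zeta>: "0 < Im \<zeta>"
  shows "cmod (f z - f \<zeta>) * cmod (z - cnj \<zeta>) \<le> cmod (z - \<zeta>) * cmod (f z - cnj (f \<zeta>))"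
proof -
  have less: "cmod (a - b) < cmod (a - cnj b)" if "0 < Im a" "0 < Im b" for a b
    using that by (simp add: cmod_def power2_eq_square algebra_simps)
  have ne: "a - cnj b \<noteq> 0" if "0 < Im a" "0 < Im b" for a b
    using less[OF that] norm_ge_zero[of "a - b"] by (metis norm_zero order_le_less_trans less_irrefl)
  define T where "T = (\<lambda>s. (\<zeta> - cnj \<zeta> * s) / (1 - s))"
  have s1: "1 - s \<noteq> 0" if "cmod s < 1" for s
    using that by auto
  have ImT: "0 < Im (T s)" if "cmod s < 1" for s
  proof -
    have "T s = (\<zeta> - cnj \<zeta> * s) * cnj (1 - s) / of_real ((cmod (1 - s))\<^sup>2)"
      unfolding T_def using complex_div_cnj[of "\<zeta> - cnj \<zeta> * s" "1 - s"] by simp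
    then have "Im (T s) = Im ((\<zeta> - cnj \<zeta> * s) * cnj (1 - s)) / (cmod (1 - s))\<^sup>2"
      by (simp add: Im_divide_of_real)
    also have "Im ((\<zeta> - cnj \<zeta> * s) * cnj (1 - s)) = Im \<zeta> * (1 - (cmod s)\<^sup>2)"
      unfolding cmod_power2 by (simp add: algebra_simps power2_eq_square)
    finally show ?thesis
      using that \<zeta> s1[OF that] by (simp add: abs_square_less_1)
  qed
  define h where "h = (\<lambda>s. (f (T s) - f \<zeta>) / (f (T s) - cnj (f \<zeta>)))"
  have "T holomorphic_on ball 0 1"
    unfolding T_def using s1 by (intro holomorphic_intros) auto
  moreover have "T ` ball 0 1 \<subseteq> upper_half_plane"
    using ImT by (auto simp: upper_half_plane_def)
  ultimately have "(\<lambda>s. f (T s)) holomorphic_on ball 0 1"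
    using holomorphic_on_compose_gen[OF _ hol] by (auto simp: o_def)
  then have "h holomorphic_on ball 0 1"
    unfolding h_def using ne[OF pos[OF ImT] pos[OF \<zeta>]] by (intro holomorphic_intros) auto
  moreover have "h 0 = 0" by (simp add: h_def T_def)
  moreover have "cmod (h s) < 1" if "cmod s < 1" for s
    unfolding h_def norm_divide
    using less[OF pos[OF ImT[OF that]] pos[OF \<zeta>]] ne[OF pos[OF ImT[OF that]] pos[OF \<zeta>]] by simp
  moreover
  define s where "s = (z - \<zeta>) / (z - cnj \<zeta>)"
  have "cmod s < 1"
    unfolding s_def norm_divide using less[OF z \<zeta>] ne[OF z \<zeta>] by simp
  ultimately have "cmod (h s) \<le> cmod s"
    by (intro Schwarz_Lemma(1)) auto
  moreover have "T s = z"
  proof -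
    have "\<zeta> - cnj \<zeta> * s = z * (1 - s)"
      unfolding s_def using ne[OF z \<zeta>] by (simp add: divide_simps) (simp add: algebra_simps)
    then show ?thesis
      unfolding T_def using s1[OF \<open>cmod s < 1\<close>] by simp
  qed
  ultimately show ?thesis
    unfolding h_def s_def norm_divide using ne[OF z \<zeta>] ne[OF pos[OF z] pos[OF \<zeta>]]
    by (simp add: divide_simps mult.commute split: if_splits)
qed

lemma cmod_diff_cnj_power2: "(cmod (a - cnj b))\<^sup>2 = (cmod (a - b))\<^sup>2 + 4 * (Im a * Im b)"
  unfolding cmod_power2 by (simp add: algebra_simps power2_eq_square)

text \<open>Squaring \<open>schwarz_pick_aux\<close> and expanding by
  \<open>cmod_diff_cnj_power2\<close> puts the same product of squared distances on both sides, and
  it cancels. The result contains no quotient, so it survives real values of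
  \<open>f\<close>.\<close>

lemma schwarz_pick:
  assumes f: "nevanlinna f" and z: "0 < Im z" and \<zeta>: "0 < Im \<zeta>"
  shows "(cmod (f z - f \<zeta>))\<^sup>2 * (Im z * Im \<zeta>) \<le> (cmod (z - \<zeta>))\<^sup>2 * (Im (f z) * Im (f \<zeta>))"
proof -
  have *: "(cmod (f z - f \<zeta>))\<^sup>2 * (Im z * Im \<zeta>)
      \<le> (cmod (z - \<zeta>))\<^sup>2 * ((Im (f z) + \<epsilon>) * (Im (f \<zeta>) + \<epsilon>))" if "\<epsilon> > 0" for \<epsilon> :: real
  proof -
    \<comment> \<open>The shift makes the imaginary part strictly positive, as the disc argument
      demands, and leaves differences of values unchanged; it is removed by letting \<epsilon> tend
      to 0.\<close>
    define g where "g = (\<lambda>z. f z + \<i> * of_real \<epsilon>)"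
    have "cmod (g z - g \<zeta>) * cmod (z - cnj \<zeta>) \<le> cmod (z - \<zeta>) * cmod (g z - cnj (g \<zeta>))"
      using f that unfolding g_def nevanlinna_def upper_half_plane_def
      by (intro schwarz_pick_aux[OF _ _ z \<zeta>]) (auto intro!: holomorphic_intros add_nonneg_pos
          simp: upper_half_plane_def)
    then have "(cmod (g z - g \<zeta>))\<^sup>2 * (cmod (z - cnj \<zeta>))\<^sup>2
        \<le> (cmod (z - \<zeta>))\<^sup>2 * (cmod (g z - cnj (g \<zeta>)))\<^sup>2"
      unfolding power_mult_distrib[symmetric] by (rule power_mono) simp
    then have "(cmod (g z - g \<zeta>))\<^sup>2 * (Im z * Im \<zeta>) \<le> (cmod (z - \<zeta>))\<^sup>2 * (Im (g z) * Im (g \<zeta>))"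
      unfolding cmod_diff_cnj_power2 by (simp add: algebra_simps)
    then show ?thesis by (simp add: g_def)
  qed
  have "((\<lambda>\<epsilon>. (cmod (z - \<zeta>))\<^sup>2 * ((Im (f z) + \<epsilon>) * (Im (f \<zeta>) + \<epsilon>)))
      \<longlongrightarrow> (cmod (z - \<zeta>))\<^sup>2 * ((Im (f z) + 0) * (Im (f \<zeta>) + 0))) (at_right 0)"
    by (intro tendsto_intros)
  then have "(cmod (f z - f \<zeta>))\<^sup>2 * (Im z * Im \<zeta>)
      \<le> (cmod (z - \<zeta>))\<^sup>2 * ((Im (f z) + 0) * (Im (f \<zeta>) + 0))"
    using eventually_at_right_less[of "0::real"]
    by (intro tendsto_lowerbound[where F = "at_right 0"]) (auto elim!: eventually_mono intro: *)
  then show ?thesis by simp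
qed

section \<open>Nontangential limits\<close>

lemma eventually_at_nontangential:
  "eventually P (at_nontangential x) \<longleftrightarrow>
    (\<forall>M>0. eventually P (at (of_real x) within stolz_angle x M))"
  unfolding at_nontangential_def by (subst eventually_Sup) auto

lemma eventually_at_nontangential_Im: "\<forall>\<^sub>F z in at_nontangential x. 0 < Im z"
  unfolding eventually_at_nontangential
  by (auto simp: eventually_at_filter stolz_angle_def upper_half_plane_def)

lemma at_nontangential_le: "at_nontangential x \<le> at (of_real x)"
  unfolding le_filter_def eventually_at_nontangential
  by (auto simp: eventually_at_filter elim: eventually_mono)

lemma nontangential_isCont:
  assumes "isCont f (complex_of_real y)" "f (of_real y) = v"
  shows "(f \<longlongrightarrow> v) (at_nontangential y)"
  using assms tendsto_mono[OF at_nontangential_le] by (auto simp: isCont_def)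

lemma tendsto_at_nontangential_ident: "((\<lambda>z. z) \<longlongrightarrow> of_real x) (at_nontangential x)"
  by (rule tendsto_mono[OF at_nontangential_le]) simp

lemma vertical_tendsto:
  "filterlim (\<lambda>y. Complex x y) (at_nontangential x) (at_right 0)"
proof -
  have "filterlim (\<lambda>y. Complex x y) (at (of_real x) within stolz_angle x 1) (at_right 0)"
    unfolding filterlim_at
  proof
    have "((\<lambda>y. Complex x y) \<longlongrightarrow> Complex x 0) (at_right 0)"
      by (intro tendsto_intros tendsto_Complex)
    then show "((\<lambda>y. Complex x y) \<longlongrightarrow> of_real x) (at_right 0)"
      by (simp add: complex_of_real_def)
    show "\<forall>\<^sub>F y in at_right 0. Complex x y \<in> stolz_angle x 1 \<and> Complex x y \<noteq> of_real x"
      using eventually_at_right_less[of "0::real"]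
      by eventually_elim (auto simp: stolz_angle_def upper_half_plane_def complex_of_real_def)
  qed
  moreover have "at (of_real x) within stolz_angle x 1 \<le> at_nontangential x"
    by (auto simp: le_filter_def eventually_at_nontangential)
  ultimately show ?thesis
    by (rule filterlim_mono[OF _ _ order_refl])
qed

text \<open>This is what makes nontangential limits unique; the vertical approach witnesses that the
  filter is proper.\<close>

lemma at_nontangential_neq_bot: "at_nontangential x \<noteq> bot"
proof
  assume "at_nontangential x = bot"
  then have "filterlim (\<lambda>y. Complex x y) bot (at_right 0)"
    using vertical_tendsto[of x] by simp
  then show False
    by (simp add: filterlim_def filtermap_bot_iff bot_unique)
qed

text \<open>The radius is matched to the aperture. With \<open>y = Im z / (M + 2)\<close>, points of
  the disc have height at least (M + 1) y and horizontal distance from x at most M (M + 2) y + y =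
  (M + 1)^2 y.\<close>

lemma cball_subset_stolz_angle:
  assumes z: "z \<in> stolz_angle x M" and M: "M > 0" and \<zeta>: "dist z \<zeta> \<le> Im z / (M + 2)"
  shows "\<zeta> \<in> stolz_angle x (M + 1)"
proof -
  define y where "y = Im z / (M + 2)"
  have z': "0 < Im z" "\<bar>Re z - x\<bar> \<le> M * Im z"
    using z by (auto simp: stolz_angle_def upper_half_plane_def)
  have y: "Im z = (M + 2) * y" "y > 0"
    using M z' by (auto simp: y_def)
  have "\<bar>Re z - Re \<zeta>\<bar> \<le> y" "\<bar>Im z - Im \<zeta>\<bar> \<le> y"
    using \<zeta> abs_Re_le_cmod[of "z - \<zeta>"] abs_Im_le_cmod[of "z - \<zeta>"]
    by (auto simp: y_def dist_norm)
  then have Im: "Im \<zeta> \<ge> (M + 1) * y" and Re: "\<bar>Re \<zeta> - x\<bar> \<le> M * Im z + y"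
    using z'(2) y by (auto simp: algebra_simps)
  have "M * Im z + y = (M + 1) * ((M + 1) * y)"
    by (simp add: y algebra_simps)
  also have "\<dots> \<le> (M + 1) * Im \<zeta>"
    using M Im by (intro mult_left_mono) auto
  finally have "\<bar>Re \<zeta> - x\<bar> \<le> (M + 1) * Im \<zeta>"
    using Re by simp
  moreover have "0 < (M + 1) * y"
    using M y by simp
  ultimately show ?thesis
    using Im by (auto simp: stolz_angle_def upper_half_plane_def)
qed

lemma stolz_angle_norm_le:
  assumes "z \<in> stolz_angle x M"
  shows "cmod (z - of_real x) \<le> (M + 1) * Im z"
  using cmod_le[of "z - of_real x"] assms
  by (auto simp: stolz_angle_def upper_half_plane_def algebra_simps)

text \<open>Since the filter treats all apertures at once, passing to the angle M + 1 is harmless.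
  The discs make eventual properties available for Cauchy's estimate and on neighbourhoods.\<close>

lemma eventually_at_nontangential_cball:
  assumes P: "eventually P (at_nontangential x)" and M: "M > 0"
  shows "\<forall>\<^sub>F z in at (of_real x) within stolz_angle x M. \<forall>\<zeta>\<in>cball z (Im z / (M + 2)). P \<zeta>"
proof -
  have "eventually P (at (of_real x) within stolz_angle x (M + 1))"
    using P M by (simp add: eventually_at_nontangential)
  then obtain d where d: "d > 0"
    "\<And>z. z \<in> stolz_angle x (M + 1) \<Longrightarrow> z \<noteq> of_real x \<Longrightarrow> dist z (of_real x) < d \<Longrightarrow> P z"
    unfolding eventually_at by auto
  show ?thesis
    unfolding eventually_at
  proof (intro exI[of _ "d / 2"] conjI ballI impI)
    show "0 < d / 2" using d by simp
    fix z \<zeta> assume z: "z \<in> stolz_angle x M" "z \<noteq> of_real x \<and> dist z (of_real x) < d / 2"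
      and "\<zeta> \<in> cball z (Im z / (M + 2))"
    then have \<zeta>: "dist z \<zeta> \<le> Im z / (M + 2)" by simp
    have S: "\<zeta> \<in> stolz_angle x (M + 1)"
      by (rule cball_subset_stolz_angle[OF z(1) M \<zeta>])
    then have "\<zeta> \<noteq> of_real x"
      by (auto simp: stolz_angle_def upper_half_plane_def)
    have y: "0 < Im z" "Im z \<le> cmod (z - of_real x)"
      using z abs_Im_le_cmod[of "z - of_real x"] by (auto simp: stolz_angle_def upper_half_plane_def)
    have "Im z / (M + 2) \<le> Im z / 1"
      using y M by (intro divide_left_mono) auto
    then have "dist z \<zeta> \<le> dist z (of_real x)"
      using \<zeta> y by (simp add: dist_norm)
    moreover have "dist \<zeta> (of_real x) \<le> dist z \<zeta> + dist z (of_real x)"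
      by (metis dist_commute dist_triangle)
    ultimately have "dist \<zeta> (of_real x) < d"
      using z by linarith
    with d S \<open>\<zeta> \<noteq> of_real x\<close> show "P \<zeta>" by auto
  qed
qed

lemma eventually_at_nontangential_nhds:
  assumes P: "eventually P (at_nontangential x)"
  shows "\<forall>\<^sub>F z in at_nontangential x. eventually P (nhds z)"
  unfolding eventually_at_nontangential
proof (intro allI impI)
  fix M :: real assume M: "M > 0"
  have "\<forall>\<^sub>F z in at (of_real x) within stolz_angle x M. z \<in> stolz_angle x M"
    by (simp add: eventually_at_filter)
  then show "\<forall>\<^sub>F z in at (of_real x) within stolz_angle x M. eventually P (nhds z)"
    using eventually_at_nontangential_cball[OF P M]
  proof eventually_elim
    case (elim z)
    then have "Im z / (M + 2) > 0"
      using M by (auto simp: stolz_angle_def upper_half_plane_def)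
    then show ?case
      using elim unfolding eventually_nhds_metric
      by (intro exI[of _ "Im z / (M + 2)"]) (auto simp: dist_commute)
  qed
qed

text \<open>Cauchy's estimate on discs whose radius is comparable to the distance from the boundary point.\<close>

lemma nontangential_limit_deriv:
  assumes hol: "F holomorphic_on upper_half_plane"
    and lim: "(F \<longlongrightarrow> c) (at_nontangential x)"
  shows "((\<lambda>z. (z - of_real x) * deriv F z) \<longlongrightarrow> 0) (at_nontangential x)"
  unfolding tendsto_iff eventually_at_nontangential
proof (intro allI impI)
  fix e M :: real assume e: "e > 0" and M: "M > 0"
  \<comment> \<open>\<open>Q\<close> bounds the ratio of \<open>cmod (z - of_real x)\<close> to the
    Cauchy radius \<open>Im z / (M + 2)\<close>, so the final estimate is e' Q = e / 2.\<close>
  define Q where "Q = (M + 1) * (M + 2)"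
  define e' where "e' = e / (2 * Q)"
  have Q: "Q > 0" using M by (simp add: Q_def)
  have e': "e' > 0" using e Q by (simp add: e'_def)
  have ev: "\<forall>\<^sub>F z in at_nontangential x. dist (F z) c < e' \<and> 0 < Im z"
    using lim e' eventually_at_nontangential_Im by (auto simp: tendsto_iff intro: eventually_conj)
  have "\<forall>\<^sub>F z in at (of_real x) within stolz_angle x M. z \<in> stolz_angle x M"
    by (simp add: eventually_at_filter)
  then show "\<forall>\<^sub>F z in at (of_real x) within stolz_angle x M.
      dist ((z - of_real x) * deriv F z) 0 < e"
    using eventually_at_nontangential_cball[OF ev M]
  proof eventually_elim
    case (elim z)
    define r where "r = Im z / (M + 2)"
    have r: "r > 0" "Im z = (M + 2) * r"
      using elim M by (auto simp: r_def stolz_angle_def upper_half_plane_def)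
    have sub: "cball z r \<subseteq> upper_half_plane"
      using elim by (auto simp: r_def upper_half_plane_def)
    have "cmod ((deriv ^^ 1) (\<lambda>z. F z - c) z) \<le> fact 1 * e' / r ^ 1"
    proof (rule Cauchy_inequality)
      have "(\<lambda>z. F z - c) holomorphic_on cball z r"
        by (intro holomorphic_intros holomorphic_on_subset[OF hol sub])
      then show "continuous_on (cball z r) (\<lambda>z. F z - c)" "(\<lambda>z. F z - c) holomorphic_on ball z r"
        by (auto intro: holomorphic_on_imp_continuous_on holomorphic_on_subset)
      show "cmod (F u - c) \<le> e'" if "cmod (z - u) = r" for u
        using elim that by (auto simp: dist_norm r_def less_imp_le)
    qed (use r in auto)
    moreover have "F field_differentiable at z"
      using hol open_upper_half_plane elim M
      by (intro holomorphic_on_imp_differentiable_at[OF hol]) (auto simp: stolz_angle_def)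
    then have "deriv (\<lambda>z. F z - c) z = deriv F z"
      by (subst deriv_diff) auto
    ultimately have D: "cmod (deriv F z) \<le> e' / r" by simp
    have "cmod ((z - of_real x) * deriv F z) \<le> ((M + 1) * ((M + 2) * r)) * (e' / r)"
      unfolding norm_mult r(2)[symmetric] using stolz_angle_norm_le[of z x M] elim D M
      by (intro mult_mono) (auto simp: stolz_angle_def upper_half_plane_def)
    also have "\<dots> = e' * ((M + 1) * (M + 2))"
      using r by simp
    also have "\<dots> = e / 2"
      using Q by (simp add: e'_def flip: Q_def)
    also have "\<dots> < e" using e by simp
    finally show ?case by simp
  qed
qed

lemma tendsto_at_nontangential_minus:
  "((\<lambda>z. z - of_real x) \<longlongrightarrow> 0) (at_nontangential x)"
  using tendsto_diff[OF tendsto_at_nontangential_ident tendsto_const, of x "of_real x"] by simp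

section \<open>Point masses of Nevanlinna functions\<close>

text \<open>
  \<open>-m/(z - x)\<close> is the contribution of the point mass at \<open>x\<close> of the measure
  representing \<open>f\<close>. Julia's argument gives it without the integral representation: \<open>m\<close> is
  the infimum of \<open>Im f\<close> divided by \<open>Im (-1/(z - x))\<close>.
\<close>

lemma nevanlinna_point_mass:
  assumes f: "nevanlinna f"
  obtains m :: real where "m \<ge> 0" "nevanlinna (\<lambda>z. f z + of_real m / (z - of_real x))"
    "\<And>\<epsilon>. \<epsilon> > 0 \<Longrightarrow> \<exists>z\<in>upper_half_plane.
       Im (f z + of_real m / (z - of_real x)) * (cmod (z - of_real x))\<^sup>2 < \<epsilon> * Im z"
proof -
  define q where "q = (\<lambda>z. Im (f z) * (cmod (z - of_real x))\<^sup>2 / Im z)"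
  define m where "m = Inf (q ` upper_half_plane)"
  have ne: "q ` upper_half_plane \<noteq> {}"
    by (auto simp: upper_half_plane_def intro: exI[of _ \<i>])
  have q0: "q z \<ge> 0" if "z \<in> upper_half_plane" for z
    using f that by (auto simp: q_def nevanlinna_def upper_half_plane_def)
  have bdd: "bdd_below (q ` upper_half_plane)"
    using q0 by (auto intro!: bdd_belowI[of _ 0])
  have Im: "Im (f z + of_real m / (z - of_real x)) * (cmod (z - of_real x))\<^sup>2 = (q z - m) * Im z"
    if "z \<in> upper_half_plane" for z
  proof -
    have z: "Im z > 0" using that by (simp add: upper_half_plane_def)
    then have "z - of_real x \<noteq> 0" by (auto simp: complex_eq_iff)
    then have n: "(cmod (z - of_real x))\<^sup>2 > 0" by simp
    have "Im (of_real m / (z - of_real x)) = - m * Im z / (cmod (z - of_real x))\<^sup>2"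
      unfolding Im_divide cmod_power2 by simp
    then have "Im (f z + of_real m / (z - of_real x)) = Im (f z) - m * Im z / (cmod (z - of_real x))\<^sup>2"
      by simp
    also have "\<dots> * (cmod (z - of_real x))\<^sup>2 = (q z - m) * Im z"
      using z n by (simp add: q_def left_diff_distrib)
    finally show ?thesis .
  qed
  show thesis
  proof (rule that[of m])
    show "m \<ge> 0" unfolding m_def using ne q0 by (intro cInf_greatest) auto
    have "Im (f z + of_real m / (z - of_real x)) \<ge> 0" if z: "z \<in> upper_half_plane" for z
    proof -
      have "m \<le> q z" unfolding m_def using bdd z by (intro cInf_lower) auto
      then have "Im (f z + of_real m / (z - of_real x)) * (cmod (z - of_real x))\<^sup>2 \<ge> 0"
        using Im[OF z] z by (simp add: upper_half_plane_def)
      moreover have "(cmod (z - of_real x))\<^sup>2 > 0"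
        using z by (auto simp: upper_half_plane_def)
      ultimately show ?thesis
        by (simp add: zero_le_mult_iff)
    qed
    then show "nevanlinna (\<lambda>z. f z + of_real m / (z - of_real x))"
      using f unfolding nevanlinna_def
      by (auto intro!: holomorphic_intros simp: upper_half_plane_def)
    show "\<exists>z\<in>upper_half_plane.
        Im (f z + of_real m / (z - of_real x)) * (cmod (z - of_real x))\<^sup>2 < \<epsilon> * Im z"
      if "\<epsilon> > 0" for \<epsilon>
    proof -
      have "\<exists>t\<in>q ` upper_half_plane. t < m + \<epsilon>"
        using that ne unfolding m_def by (intro cInf_lessD) auto
      then obtain z where z: "z \<in> upper_half_plane" "q z - m < \<epsilon>" by auto
      then show ?thesis
        using Im[OF z(1)] by (intro bexI[of _ z]) (auto simp: upper_half_plane_def)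
    qed
  qed
qed

text \<open>Assumption \<open>inf\<close> says that the infimum of Julia's quotient is 0: there is
  no point mass at x. One point \<open>a\<close> with small quotient controls all z near x, because
  Schwarz-Pick bounds the square of \<open>D = cmod (f z - f a)\<close> by a small multiple of
  \<open>Im (f z) / Im z\<close>, and \<open>Im (f z)\<close> grows at most linearly in
  \<open>D\<close>.\<close>

lemma nontangential_residue_zero:
  assumes f: "nevanlinna f"
    and inf: "\<And>\<epsilon>. \<epsilon> > 0 \<Longrightarrow> \<exists>z\<in>upper_half_plane. Im (f z) * (cmod (z - of_real x))\<^sup>2 < \<epsilon> * Im z"
  shows "((\<lambda>z. (z - of_real x) * f z) \<longlongrightarrow> 0) (at_nontangential x)"
  unfolding tendsto_iff eventually_at_nontangential
proof (intro allI impI)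
  fix e M :: real assume e: "e > 0" and M: "M > 0"
  \<comment> \<open>Chosen so that 4 (M + 1) \<epsilon> = e / 4: the 4 comes from |z - a| \<le> 2 |a
    - x|, and M + 1 from comparing |z - x| with Im z in the Stolz angle.\<close>
  define \<epsilon> where "\<epsilon> = e / (16 * (M + 1))"
  have \<epsilon>: "\<epsilon> > 0" using e M by (simp add: \<epsilon>_def)
  obtain a where a: "Im a > 0" and fa: "Im (f a) * (cmod (a - of_real x))\<^sup>2 < \<epsilon> * Im a"
    using inf[OF \<epsilon>] by (auto simp: upper_half_plane_def)
  have ax: "cmod (a - of_real x) > 0" using a by auto
  define K where "K = cmod (f a)"
  have "\<forall>\<^sub>F z in at (of_real x) within stolz_angle x M. z \<in> stolz_angle x M"
    by (simp add: eventually_at_filter)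
  moreover have "\<forall>\<^sub>F z in at (of_real x) within stolz_angle x M. dist z (of_real x) < cmod (a - of_real x)"
    using ax tendstoD[OF tendsto_ident_at, of "cmod (a - of_real x)" "complex_of_real x"] by blast
  moreover have "\<forall>\<^sub>F z in at (of_real x) within stolz_angle x M. dist z (of_real x) < e / (4 * (K + 1))"
    using e tendstoD[OF tendsto_ident_at, of "e / (4 * (K + 1))" "complex_of_real x"]
    by (simp add: K_def add_nonneg_pos)
  ultimately show "\<forall>\<^sub>F z in at (of_real x) within stolz_angle x M. dist ((z - of_real x) * f z) 0 < e"
  proof eventually_elim
    case (elim z)
    define t where "t = cmod (z - of_real x)"
    have y: "Im z > 0" and tM: "t \<le> (M + 1) * Im z"
      using elim stolz_angle_norm_le[of z x M] by (auto simp: stolz_angle_def upper_half_plane_def t_def)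
    have t: "t > 0" using y by (auto simp: t_def)
    define D where "D = cmod (f z - f a)"
    have "cmod (z - a) \<le> cmod (z - of_real x) + cmod (a - of_real x)"
      using norm_triangle_ineq4[of "z - of_real x" "a - of_real x"] by simp
    then have za: "(cmod (z - a))\<^sup>2 \<le> (2 * cmod (a - of_real x))\<^sup>2"
      using elim by (intro power_mono) (auto simp: dist_norm)
    have fz0: "0 \<le> Im (f z)" "0 \<le> Im (f a)"
      using f y a by (auto simp: nevanlinna_def upper_half_plane_def)
    have "D\<^sup>2 * (Im z * Im a) \<le> (cmod (z - a))\<^sup>2 * (Im (f z) * Im (f a))"
      unfolding D_def by (rule schwarz_pick[OF f y a])
    also have "\<dots> \<le> (2 * cmod (a - of_real x))\<^sup>2 * (Im (f z) * Im (f a))"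
      using za fz0 by (intro mult_right_mono) auto
    also have "\<dots> = 4 * Im (f z) * (Im (f a) * (cmod (a - of_real x))\<^sup>2)"
      by (simp add: power_mult_distrib)
    also have "\<dots> \<le> 4 * Im (f z) * (\<epsilon> * Im a)"
      using fa fz0 by (intro mult_left_mono) auto
    finally have "(D\<^sup>2 * Im z) * Im a \<le> (4 * Im (f z) * \<epsilon>) * Im a"
      by (simp add: algebra_simps)
    then have D1: "D\<^sup>2 * Im z \<le> 4 * Im (f z) * \<epsilon>"
      using a by simp
    have fz: "cmod (f z) \<le> K + D"
      using norm_triangle_ineq[of "f a" "f z - f a"] by (simp add: K_def D_def)
    have "D\<^sup>2 * t \<le> D\<^sup>2 * ((M + 1) * Im z)"
      using tM by (intro mult_left_mono) auto
    also have "\<dots> = (M + 1) * (D\<^sup>2 * Im z)" by simp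
    also have "\<dots> \<le> (M + 1) * (4 * Im (f z) * \<epsilon>)"
      using M D1 by (intro mult_left_mono) auto
    also have "\<dots> = (e / 4) * Im (f z)"
      using M by (simp add: \<epsilon>_def field_simps)
    also have "\<dots> \<le> (e / 4) * (K + D)"
      using e fz abs_Im_le_cmod[of "f z"] by (intro mult_left_mono) auto
    finally have D2: "D\<^sup>2 * t \<le> (e / 4) * (K + D)" .
    have Kt: "t * K < e / 4"
    proof -
      have "t * K \<le> t * (K + 1)" using t by simp
      also have "\<dots> < e / (4 * (K + 1)) * (K + 1)"
        using elim by (intro mult_strict_right_mono) (auto simp: t_def dist_norm K_def add_nonneg_pos)
      also have "\<dots> = e / 4"
        using norm_ge_zero[of "f a"] by (simp add: K_def field_simps add_nonneg_eq_0_iff)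
      finally show ?thesis .
    qed
    \<comment> \<open>Small \<open>D\<close> is absorbed by \<open>Kt\<close>; for large
      \<open>D\<close> one factor \<open>D\<close> cancels from the quadratic bound
      \<open>D2\<close>.\<close>
    have "t * (K + D) < e"
    proof (cases "D \<le> K")
      case True
      then have "t * D \<le> t * K" using t by simp
      then show ?thesis using Kt e by (simp add: distrib_left)
    next
      case False
      then have "D > 0" using norm_ge_zero[of "f a"] unfolding K_def by linarith
      have "(e / 4) * (K + D) \<le> (e / 4) * (2 * D)"
        using e False by (intro mult_left_mono) auto
      then have "(D * t) * D \<le> (e / 2) * D"
        using D2 by (simp add: power2_eq_square algebra_simps)
      then have "D * t \<le> e / 2"
        using \<open>D > 0\<close> by (simp add: mult_ac)
      then show ?thesis using Kt e by (simp add: algebra_simps)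
    qed
    moreover have "t * cmod (f z) \<le> t * (K + D)"
      using fz t by simp
    ultimately show ?case by (simp add: norm_mult t_def)
  qed
qed

text \<open>The expression is the diagonal kernel of -1/f. If it stayed bounded by K' along some
  approach to x, Schwarz-Pick against a fixed \<open>a\<close>, divided by |f z|^2, would give in
  the limit the lower bound 1/K' for Julia's quotient at every \<open>a\<close>, contradicting
  \<open>inf\<close>.\<close>

lemma nontangential_kernel_at_top:
  assumes f: "nevanlinna f"
    and inf: "\<And>\<epsilon>. \<epsilon> > 0 \<Longrightarrow> \<exists>z\<in>upper_half_plane. Im (f z) * (cmod (z - of_real x))\<^sup>2 < \<epsilon> * Im z"
    and lim: "filterlim f at_infinity (at_nontangential x)"
  shows "filterlim (\<lambda>z. Im (f z) / (Im z * (cmod (f z))\<^sup>2)) at_top (at_nontangential x)"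
proof (rule ccontr)
  define F where "F = at_nontangential x"
  assume "\<not> ?thesis"
  then obtain K where "\<not> (\<forall>\<^sub>F z in F. K < Im (f z) / (Im z * (cmod (f z))\<^sup>2))" 
    unfolding filterlim_at_top_dense F_def by blast
  then have fr: "\<exists>\<^sub>F z in F. Im (f z) / (Im z * (cmod (f z))\<^sup>2) \<le> K"
    by (simp add: frequently_def not_less not_le)
  define K' where "K' = max K 1"
  \<comment> \<open>\<open>G\<close> restricts the filter to the points where the kernel is bounded;
    it is proper because the negated limit says that such points occur frequently.\<close>
  define G where "G = inf F (principal {z. Im (f z) / (Im z * (cmod (f z))\<^sup>2) \<le> K'})"
  have "\<exists>\<^sub>F z in F. Im (f z) / (Im z * (cmod (f z))\<^sup>2) \<le> K'"
    using fr by (rule frequently_elim1) (auto simp: K'_def)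
  then have G: "G \<noteq> bot"
    unfolding G_def by (simp add: trivial_limit_def eventually_inf_principal frequently_def)
  have GF: "G \<le> F" by (simp add: G_def)
  have limG: "filterlim f at_infinity G"
    using lim GF unfolding F_def by (rule filterlim_mono[OF _ order_refl])
  have idG: "((\<lambda>z. z) \<longlongrightarrow> of_real x) G"
    using GF tendsto_at_nontangential_ident unfolding F_def by (rule tendsto_mono)
  have evG: "\<forall>\<^sub>F z in G. Im z > 0 \<and> Im (f z) / (Im z * (cmod (f z))\<^sup>2) \<le> K' \<and> f z \<noteq> 0"
  proof (intro eventually_conj)
    show "\<forall>\<^sub>F z in G. 0 < Im z"
      using GF eventually_at_nontangential_Im unfolding F_def by (rule filter_leD)
    show "\<forall>\<^sub>F z in G. Im (f z) / (Im z * (cmod (f z))\<^sup>2) \<le> K'"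
      by (simp add: G_def eventually_inf_principal)
    show "\<forall>\<^sub>F z in G. f z \<noteq> 0"
      using filterlim_at_infinity_imp_eventually_ne[OF limG] .
  qed
  have key: "Im a \<le> (cmod (a - of_real x))\<^sup>2 * (Im (f a) * K')" if a: "Im a > 0" for a
  proof -
    have L: "((\<lambda>z. (cmod (f a / f z - 1))\<^sup>2 * Im a) \<longlongrightarrow> (cmod (0 - 1))\<^sup>2 * Im a) G"
      by (intro tendsto_intros tendsto_divide_0[OF tendsto_const] limG)
    have R: "((\<lambda>z. (cmod (a - z))\<^sup>2 * (Im (f a) * K')) \<longlongrightarrow> (cmod (a - of_real x))\<^sup>2 * (Im (f a) * K')) G"
      by (intro tendsto_intros idG)
    have "\<forall>\<^sub>F z in G. (cmod (f a / f z - 1))\<^sup>2 * Im a \<le> (cmod (a - z))\<^sup>2 * (Im (f a) * K')"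
      using evG
    proof eventually_elim
      case (elim z)
      have fa: "Im (f a) \<ge> 0" using f a by (auto simp: nevanlinna_def upper_half_plane_def)
      have *: "(cmod (f z))\<^sup>2 > 0" using elim by simp
      have "f a / f z - 1 = (f a - f z) / f z"
        using elim by (simp add: diff_divide_distrib)
      then have "(cmod (f a / f z - 1))\<^sup>2 * (cmod (f z))\<^sup>2 = (cmod (f a - f z))\<^sup>2"
        using elim by (simp add: norm_divide power_divide)
      then have "((cmod (f a / f z - 1))\<^sup>2 * Im a) * (Im z * (cmod (f z))\<^sup>2)
          = (cmod (f a - f z))\<^sup>2 * (Im a * Im z)"
        by (metis mult.assoc mult.commute)
      also have "\<dots> \<le> (cmod (a - z))\<^sup>2 * (Im (f a) * Im (f z))"
        using elim by (intro schwarz_pick[OF f a]) auto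
      also have "\<dots> \<le> (cmod (a - z))\<^sup>2 * (Im (f a) * (K' * (Im z * (cmod (f z))\<^sup>2)))"
        using elim fa * by (intro mult_left_mono) (auto simp: field_simps)
      finally have "((cmod (f a / f z - 1))\<^sup>2 * Im a) * (Im z * (cmod (f z))\<^sup>2)
          \<le> ((cmod (a - z))\<^sup>2 * (Im (f a) * K')) * (Im z * (cmod (f z))\<^sup>2)"
        by (simp add: algebra_simps)
      then show ?case
        using elim * by (simp add: mult_le_cancel_right)
    qed
    from tendsto_le[OF G R L this] show ?thesis by simp
  qed
  have K': "K' > 0" by (simp add: K'_def)
  then obtain a where a: "Im a > 0" "Im (f a) * (cmod (a - of_real x))\<^sup>2 < 1 / K' * Im a"
    using inf[of "1 / K'"] by (auto simp: upper_half_plane_def)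
  then have "(Im (f a) * (cmod (a - of_real x))\<^sup>2) * K' < 1 / K' * Im a * K'"
    using K' by (intro mult_strict_right_mono) auto
  then show False
    using key[OF a(1)] K' by (simp add: algebra_simps)
qed

section \<open>Boundary derivatives of quotients\<close>

text \<open>The formula for \<open>f\<close> is silent at zeros of \<open>D\<close>, so a pole is
  detected from a punctured neighbourhood. There \<open>f\<close> stays within 1 of
  \<open>w\<close>, hence |(u - x) N u| \<le> |D u|; by continuity a zero of \<open>D\<close> would
  be a zero of \<open>N\<close>, which \<open>N0\<close> excludes near x.\<close>

lemma eventually_denominator_nonzero:
  assumes N: "N holomorphic_on upper_half_plane" and D: "D holomorphic_on upper_half_plane"
    and Nlim: "(N \<longlongrightarrow> N0) (at_nontangential x)" and N0: "N0 \<noteq> 0"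
    and nz: "\<exists>z\<in>upper_half_plane. D z \<noteq> 0"
    and f: "\<And>z. z \<in> upper_half_plane \<Longrightarrow> D z \<noteq> 0 \<Longrightarrow> f z = w + (z - of_real x) * (N z / D z)"
    and lim: "(f \<longlongrightarrow> w) (at_nontangential x)"
  shows "\<forall>\<^sub>F z in at_nontangential x. D z \<noteq> 0"
proof -
  have "\<forall>\<^sub>F z in at_nontangential x. dist (f z) w < 1 \<and> N z \<noteq> 0 \<and> Im z > 0"
    using tendstoD[OF lim, of 1] tendsto_imp_eventually_ne[OF Nlim N0] eventually_at_nontangential_Im[of x]
    by (auto intro: eventually_conj)
  then have "\<forall>\<^sub>F z in at_nontangential x.
      eventually (\<lambda>z. dist (f z) w < 1 \<and> N z \<noteq> 0 \<and> Im z > 0) (nhds z)"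
    by (rule eventually_at_nontangential_nhds)
  then show ?thesis
  proof eventually_elim
    case (elim z)
    have z: "N z \<noteq> 0" "z \<in> upper_half_plane"
      using eventually_nhds_x_imp_x[OF elim] by (auto simp: upper_half_plane_def)
    show "D z \<noteq> 0"
    proof
      assume D0: "D z = 0"
      have "\<forall>\<^sub>F u in at z. D u \<noteq> 0 \<and> u \<in> upper_half_plane"
        using nz z by (auto intro: non_zero_neighbour_alt[OF D open_upper_half_plane connected_upper_half_plane])
      moreover have "\<forall>\<^sub>F u in at z. dist (f u) w < 1 \<and> N u \<noteq> 0 \<and> Im u > 0"
        using elim by (simp add: eventually_nhds_conv_at)
      ultimately have ev: "\<forall>\<^sub>F u in at z. cmod ((u - of_real x) * N u) \<le> cmod (D u)"
      proof eventually_elim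
        case (elim u)
        then have "cmod ((u - of_real x) * N u / D u) < 1"
          using f[of u] by (simp add: dist_norm)
        then show ?case using elim by (simp add: norm_divide divide_simps)
      qed
      have cont: "isCont N z" "isCont D z"
        using N D open_upper_half_plane z
        by (auto intro!: field_differentiable_imp_continuous_at holomorphic_on_imp_differentiable_at)
      have "cmod ((z - of_real x) * N z) \<le> cmod (D z)"
        using cont by (intro tendsto_le[OF _ _ _ ev] tendsto_intros) (auto simp: isCont_def)
      then show False
        using z D0 by (auto simp: upper_half_plane_def)
    qed
  qed
qed

text \<open>Differentiating w + t N / D gives N / D plus terms containing t N' and t D'. By
  \<open>nontangential_limit_deriv\<close> these tend to 0, even where N' and D' are
  unbounded.\<close>

lemma boundary_quotient_regular:
  assumes N: "N holomorphic_on upper_half_plane" and D: "D holomorphic_on upper_half_plane"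
    and Nlim: "(N \<longlongrightarrow> N0) (at_nontangential x)" and Dlim: "(D \<longlongrightarrow> D0) (at_nontangential x)"
    and D0: "D0 \<noteq> 0"
    and f: "\<And>z. z \<in> upper_half_plane \<Longrightarrow> D z \<noteq> 0 \<Longrightarrow> f z = w + (z - of_real x) * (N z / D z)"
  shows "(f \<longlongrightarrow> w) (at_nontangential x)" "(deriv f \<longlongrightarrow> N0 / D0) (at_nontangential x)"
proof -
  define F where "F = at_nontangential x"
  note lims = Nlim[folded F_def] Dlim[folded F_def] tendsto_at_nontangential_minus[of x, folded F_def]
  have ev: "\<forall>\<^sub>F z in F. z \<in> upper_half_plane \<and> D z \<noteq> 0"
    using tendsto_imp_eventually_ne[OF Dlim D0] eventually_at_nontangential_Im[of x]
    unfolding F_def upper_half_plane_def by (auto intro: eventually_conj)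
  have "((\<lambda>z. w + (z - of_real x) * (N z / D z)) \<longlongrightarrow> w + 0 * (N0 / D0)) F"
    by (intro tendsto_intros lims D0)
  then show "(f \<longlongrightarrow> w) (at_nontangential x)"
    unfolding F_def[symmetric] using ev
    by (simp, elim Lim_transform_eventually) (auto elim!: eventually_mono simp: f)
  define R where "R = (\<lambda>z. N z / D z + ((z - of_real x) * deriv N z * D z - N z * ((z - of_real x) * deriv D z)) / (D z)\<^sup>2)"
  have "(R \<longlongrightarrow> N0 / D0 + (0 * D0 - N0 * 0) / D0\<^sup>2) F"
    unfolding R_def
    by (intro tendsto_intros lims D0 nontangential_limit_deriv[OF N Nlim, folded F_def]
          nontangential_limit_deriv[OF D Dlim, folded F_def]) (use D0 in simp)
  moreover have "\<forall>\<^sub>F z in F. R z = deriv f z"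
    using ev
  proof eventually_elim
    case (elim z)
    have der: "(N has_field_derivative deriv N z) (at z)" "(D has_field_derivative deriv D z) (at z)"
      using N D elim open_upper_half_plane by (auto intro: holomorphic_derivI)
    have "((\<lambda>z. w + (z - of_real x) * (N z / D z)) has_field_derivative R z) (at z)"
      using elim by (auto intro!: derivative_eq_intros der simp: R_def field_simps power2_eq_square)
    moreover have ev': "\<forall>\<^sub>F u in nhds z. f u = w + (u - of_real x) * (N u / D u)"
    proof -
      have "isCont D z" using der(2) by (rule DERIV_isCont)
      then have "\<forall>\<^sub>F u in nhds z. D u \<noteq> 0"
        using elim by (intro tendsto_imp_eventually_ne[of D "D z"]) (auto simp: continuous_within tendsto_nhds_iff)
      moreover have "\<forall>\<^sub>F u in nhds z. u \<in> upper_half_plane"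
        using elim open_upper_half_plane by (intro eventually_nhds_in_open) auto
      ultimately show ?thesis by eventually_elim (rule f)
    qed
    ultimately have "(f has_field_derivative R z) (at z)"
      using DERIV_cong_ev[OF refl ev' refl] by blast
    then show ?case by (rule DERIV_imp_deriv[symmetric])
  qed
  ultimately show "(deriv f \<longlongrightarrow> N0 / D0) (at_nontangential x)"
    unfolding F_def[symmetric] by (simp add: tendsto_cong)
qed

text \<open>The mean value inequality is applied between heights s and y, and s tends to 0
  afterwards, since \<open>f\<close> has only a limit, not a usable value, at x itself.\<close>

lemma vertical_increment_bound:
  assumes der: "\<forall>\<^sub>F z in at_nontangential x. f field_differentiable at z \<and> cmod (deriv f z) \<le> B"
    and lim: "(f \<longlongrightarrow> w) (at_nontangential x)"
  shows "\<forall>\<^sub>F y in at_right 0. cmod (f (Complex x y) - w) \<le> B * y"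
proof -
  have lim': "((\<lambda>y. f (Complex x y)) \<longlongrightarrow> w) (at_right 0)"
    by (rule filterlim_compose[OF lim vertical_tendsto])
  have "\<forall>\<^sub>F y in at_right 0. f field_differentiable at (Complex x y) \<and> cmod (deriv f (Complex x y)) \<le> B"
    using der vertical_tendsto[of x] by (rule eventually_compose_filterlim)
  then obtain b where b: "b > 0" "\<And>y. 0 < y \<Longrightarrow> y < b \<Longrightarrow>
      f field_differentiable at (Complex x y) \<and> cmod (deriv f (Complex x y)) \<le> B"
    unfolding eventually_at_right_field by auto
  show ?thesis
    unfolding eventually_at_right_field
  proof (intro exI[of _ b] conjI allI impI)
    fix y assume y: "0 < y" "y < b"
    have "cmod (f (Complex x y) - f (Complex x s)) \<le> B * (y - s)" if s: "0 < s" "s < y" for s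
    proof -
      have "cmod (f (Complex x y) - f (Complex x s)) \<le> B * cmod (Complex x y - Complex x s)"
      proof (rule field_differentiable_bound)
        show "convex (closed_segment (Complex x s) (Complex x y))" by simp
        have *: "\<exists>t. z = Complex x t \<and> s \<le> t \<and> t \<le> y"
          if "z \<in> closed_segment (Complex x s) (Complex x y)" for z
        proof (intro exI conjI)
          have "Re z = x" "Im z \<in> closed_segment s y"
            using that closed_segment_same_Re[of "Complex x s" "Complex x y"] by auto
          then show "z = Complex x (Im z)" "s \<le> Im z" "Im z \<le> y"
            using s by (auto simp: closed_segment_eq_real_ivl complex_surj)
        qed
        show "(f has_field_derivative deriv f z) (at z within closed_segment (Complex x s) (Complex x y))"
          if "z \<in> closed_segment (Complex x s) (Complex x y)" for z
          using *[OF that] b(2) s y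
          by (auto intro: has_field_derivative_at_within[OF field_differentiable_derivI])
        show "cmod (deriv f z) \<le> B"
          if "z \<in> closed_segment (Complex x s) (Complex x y)" for z
          using *[OF that] b(2) s y by auto
      qed auto
      also have "Complex x y - Complex x s = \<i> * of_real (y - s)"
        by (simp add: complex_eq_iff)
      finally show ?thesis using s by (simp add: norm_mult del: of_real_diff)
    qed
    then have "\<forall>\<^sub>F s in at_right 0. cmod (f (Complex x y) - f (Complex x s)) \<le> B * (y - s)"
      using y unfolding eventually_at_right_field by auto
    moreover have "((\<lambda>s. cmod (f (Complex x y) - f (Complex x s))) \<longlongrightarrow> cmod (f (Complex x y) - w)) (at_right 0)"
      by (intro tendsto_intros lim')
    moreover have "((\<lambda>s. B * (y - s)) \<longlongrightarrow> B * (y - 0)) (at_right 0)"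
      by (intro tendsto_intros)
    ultimately show "cmod (f (Complex x y) - w) \<le> B * y"
      using tendsto_le[of "at_right 0" "\<lambda>s. B * (y - s)" "B * (y - 0)"] by simp
  qed (use b in auto)
qed

text \<open>A convergent derivative would bound the vertical increment by B y, but that increment is
  y |N| / |D| with D tending to 0 and N not.\<close>

lemma boundary_quotient_singular:
  assumes N: "N holomorphic_on upper_half_plane" and D: "D holomorphic_on upper_half_plane"
    and Nlim: "(N \<longlongrightarrow> N0) (at_nontangential x)" and Dlim: "(D \<longlongrightarrow> 0) (at_nontangential x)"
    and N0: "N0 \<noteq> 0" and nz: "\<exists>z\<in>upper_half_plane. D z \<noteq> 0"
    and f: "\<And>z. z \<in> upper_half_plane \<Longrightarrow> D z \<noteq> 0 \<Longrightarrow> f z = w + (z - of_real x) * (N z / D z)"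
    and lim: "(f \<longlongrightarrow> w) (at_nontangential x)"
  shows "\<not> (deriv f \<longlongrightarrow> d) (at_nontangential x)"
proof
  assume der: "(deriv f \<longlongrightarrow> d) (at_nontangential x)"
  define B where "B = cmod d + 1"
  have D_ev: "\<forall>\<^sub>F z in at_nontangential x. D z \<noteq> 0 \<and> Im z > 0"
    using eventually_denominator_nonzero[OF N D Nlim N0 nz f lim] eventually_at_nontangential_Im
    by (rule eventually_conj)
  have diff: "\<forall>\<^sub>F z in at_nontangential x. f field_differentiable at z"
    using eventually_at_nontangential_nhds[OF D_ev]
  proof eventually_elim
    case (elim z)
    have z: "D z \<noteq> 0" "z \<in> upper_half_plane"
      using eventually_nhds_x_imp_x[OF elim] by (auto simp: upper_half_plane_def)
    have "N field_differentiable at z" "D field_differentiable at z"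
      using N D z open_upper_half_plane by (auto intro: holomorphic_on_imp_differentiable_at)
    then have "(\<lambda>u. w + (u - of_real x) * (N u / D u)) field_differentiable at z"
      using z by (intro field_differentiable_add field_differentiable_mult field_differentiable_diff
          field_differentiable_divide field_differentiable_const field_differentiable_ident)
    moreover have ev': "\<forall>\<^sub>F u in nhds z. f u = w + (u - of_real x) * (N u / D u)"
      using elim by eventually_elim (auto simp: f upper_half_plane_def)
    ultimately show ?case
      unfolding field_differentiable_def using DERIV_cong_ev[OF refl ev' refl] by blast
  qed
  have "\<forall>\<^sub>F z in at_nontangential x. cmod (deriv f z) < B"
    using tendsto_norm[OF der] by (rule order_tendstoD) (simp add: B_def)
  with diff have "\<forall>\<^sub>F z in at_nontangential x. f field_differentiable at z \<and> cmod (deriv f z) \<le> B"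
    by eventually_elim auto
  from vertical_increment_bound[OF this lim]
  have bound: "\<forall>\<^sub>F y in at_right 0. cmod (f (Complex x y) - w) \<le> B * y" .
  have "\<forall>\<^sub>F y in at_right 0. D (Complex x y) \<noteq> 0 \<and> Im (Complex x y) > 0"
    using D_ev vertical_tendsto[of x] by (rule eventually_compose_filterlim)
  with bound have "\<forall>\<^sub>F y in at_right 0. cmod (N (Complex x y)) \<le> B * cmod (D (Complex x y))"
  proof eventually_elim
    case (elim y)
    have "Complex x y - of_real x = \<i> * of_real y" by (simp add: complex_eq_iff)
    then have "cmod (f (Complex x y) - w) = y * (cmod (N (Complex x y)) / cmod (D (Complex x y)))"
      using elim f[of "Complex x y"] by (simp add: upper_half_plane_def norm_mult norm_divide)
    then have "y * cmod (N (Complex x y)) = cmod (f (Complex x y) - w) * cmod (D (Complex x y))"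
      using elim by simp
    also have "\<dots> \<le> B * y * cmod (D (Complex x y))"
      using elim by (intro mult_right_mono) auto
    finally have "y * cmod (N (Complex x y)) \<le> y * (B * cmod (D (Complex x y)))"
      by (simp add: mult_ac)
    then show ?case using elim by simp
  qed
  moreover have "((\<lambda>y. cmod (N (Complex x y))) \<longlongrightarrow> cmod N0) (at_right 0)"
    by (intro tendsto_norm filterlim_compose[OF Nlim vertical_tendsto])
  moreover have "((\<lambda>y. B * cmod (D (Complex x y))) \<longlongrightarrow> B * cmod 0) (at_right 0)"
    by (intro tendsto_intros filterlim_compose[OF Dlim vertical_tendsto])
  ultimately have "cmod N0 \<le> B * cmod 0"
    by (intro tendsto_le[of "at_right 0"]) auto
  then show False using N0 by simp
qed

text \<open>Assumption \<open>W\<close> has the shape in which \<open>lin_frac_Fin\<close> and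
  \<open>lin_frac_Infty\<close> describe the transform, so one criterion serves both kinds of
  parameter.\<close>

lemma boundary_quotient:
  assumes N: "N holomorphic_on upper_half_plane" and D: "D holomorphic_on upper_half_plane"
    and Nlim: "(N \<longlongrightarrow> N0) (at_nontangential x)" and Dlim: "(D \<longlongrightarrow> D0) (at_nontangential x)"
    and ND: "N0 \<noteq> 0 \<or> D0 \<noteq> 0"
    and W: "W = Infty \<and> (\<forall>z\<in>upper_half_plane. D z = 0) \<or>
      (\<exists>f. W = Fin f \<and> (\<exists>z\<in>upper_half_plane. D z \<noteq> 0) \<and>
        (\<forall>z\<in>upper_half_plane. D z \<noteq> 0 \<longrightarrow> f z = w + (z - of_real x) * (N z / D z)))"
  shows "has_boundary_deriv W x d \<and> has_boundary_value W x (Fin w) \<longleftrightarrow> D0 \<noteq> 0 \<and> d = N0 / D0"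
  using W
proof (elim disjE conjE exE)
  assume W: "W = Infty" and D0: "\<forall>z\<in>upper_half_plane. D z = 0"
  \<comment> \<open>An identically vanishing \<open>D\<close> has limit 0, so both sides of the
    equivalence are false.\<close>
  have "(D \<longlongrightarrow> 0) (at_nontangential x)"
    by (rule tendsto_eventually, rule eventually_mono[OF eventually_at_nontangential_Im])
      (use D0 in \<open>auto simp: upper_half_plane_def\<close>)
  then have "D0 = 0"
    using Dlim tendsto_unique[OF at_nontangential_neq_bot] by blast
  then show ?thesis using W by simp
next
  fix f assume W: "W = Fin f" and nz: "\<exists>z\<in>upper_half_plane. D z \<noteq> 0"
    and "\<forall>z\<in>upper_half_plane. D z \<noteq> 0 \<longrightarrow> f z = w + (z - of_real x) * (N z / D z)"
  then have f: "\<And>z. z \<in> upper_half_plane \<Longrightarrow> D z \<noteq> 0 \<Longrightarrow> f z = w + (z - of_real x) * (N z / D z)"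
    by auto
  show ?thesis
  proof (cases "D0 = 0")
    case True
    then have "\<not> (deriv f \<longlongrightarrow> d) (at_nontangential x)" if "(f \<longlongrightarrow> w) (at_nontangential x)"
      using ND Dlim that by (intro boundary_quotient_singular[OF N D Nlim _ _ nz f]) auto
    then show ?thesis
      using True W by auto
  next
    case False
    have lim: "(f \<longlongrightarrow> w) (at_nontangential x)" "(deriv f \<longlongrightarrow> N0 / D0) (at_nontangential x)"
      by (rule boundary_quotient_regular[OF N D Nlim Dlim False f]; assumption)+
    have "(deriv f \<longlongrightarrow> d) (at_nontangential x) \<longleftrightarrow> d = N0 / D0"
      using lim(2) tendsto_unique[OF at_nontangential_neq_bot] by blast
    then show ?thesis
      using False W lim(1) by simp
  qed
qed

section \<open>Kernels of linear fractional transforms\<close>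

text \<open>A quantitative substitute for being real on the real axis near x. Stated as inequalities
  rather than through holomorphy, it is closed under conjugation, so it applies to products such as
  \<open>\<alpha> z * cnj (\<gamma> z)\<close>.\<close>

definition real_like :: "real \<Rightarrow> (complex \<Rightarrow> complex) \<Rightarrow> bool" where
  "real_like x f \<longleftrightarrow> (\<exists>B. \<forall>\<^sub>F z in at_nontangential x. cmod (f z) \<le> B \<and> \<bar>Im (f z)\<bar> \<le> B * Im z)"

lemma real_likeE:
  assumes "real_like x f"
  obtains B where "B > 0"
    "\<forall>\<^sub>F z in at_nontangential x. 0 < Im z \<and> cmod (f z) \<le> B \<and> \<bar>Im (f z)\<bar> \<le> B * Im z"
proof -
  obtain B where B: "\<forall>\<^sub>F z in at_nontangential x. cmod (f z) \<le> B \<and> \<bar>Im (f z)\<bar> \<le> B * Im z"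
    using assms by (auto simp: real_like_def)
  have "\<forall>\<^sub>F z in at_nontangential x. 0 < Im z \<and> cmod (f z) \<le> max B 1 \<and> \<bar>Im (f z)\<bar> \<le> max B 1 * Im z"
    using B eventually_at_nontangential_Im
  proof eventually_elim
    case (elim z)
    have "B * Im z \<le> max B 1 * Im z"
      using elim by (intro mult_right_mono) auto
    then show ?case using elim by linarith
  qed
  then show thesis by (intro that[of "max B 1"]) auto
qed

lemma real_like_const: "real_like x (\<lambda>_. of_real r)"
  unfolding real_like_def
  by (rule exI[of _ "\<bar>r\<bar>"], rule eventually_mono[OF eventually_at_nontangential_Im]) simp

lemma real_like_ident: "real_like x (\<lambda>z. z)"
proof -
  have "\<forall>\<^sub>F z in at_nontangential x. dist z (of_real x) < 1"
    using tendstoD[OF tendsto_at_nontangential_ident, of 1 x] by simp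
  then have "\<forall>\<^sub>F z in at_nontangential x. cmod z \<le> \<bar>x\<bar> + 1 \<and> \<bar>Im z\<bar> \<le> (\<bar>x\<bar> + 1) * Im z"
    using eventually_at_nontangential_Im
  proof eventually_elim
    case (elim z)
    have "cmod z \<le> \<bar>x\<bar> + 1"
      using elim norm_triangle_ineq2[of z "of_real x"] by (simp add: dist_norm)
    then show ?case using elim by (simp add: distrib_right)
  qed
  then show ?thesis unfolding real_like_def by blast
qed

lemma real_like_uminus: "real_like x f \<Longrightarrow> real_like x (\<lambda>z. - f z)"
  and real_like_cnj: "real_like x f \<Longrightarrow> real_like x (\<lambda>z. cnj (f z))"
  by (simp_all add: real_like_def)

lemma real_like_add:
  assumes "real_like x f" "real_like x g"
  shows "real_like x (\<lambda>z. f z + g z)"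
proof -
  obtain A where A: "\<forall>\<^sub>F z in at_nontangential x. 0 < Im z \<and> cmod (f z) \<le> A \<and> \<bar>Im (f z)\<bar> \<le> A * Im z"
    using real_likeE[OF assms(1)] .
  obtain B where B: "\<forall>\<^sub>F z in at_nontangential x. 0 < Im z \<and> cmod (g z) \<le> B \<and> \<bar>Im (g z)\<bar> \<le> B * Im z"
    using real_likeE[OF assms(2)] .
  have "\<forall>\<^sub>F z in at_nontangential x. cmod (f z + g z) \<le> A + B \<and> \<bar>Im (f z + g z)\<bar> \<le> (A + B) * Im z"
    using A B by eventually_elim (auto simp: distrib_right intro: order_trans[OF norm_triangle_ineq])
  then show ?thesis unfolding real_like_def by blast
qed

lemma real_like_diff: "real_like x f \<Longrightarrow> real_like x g \<Longrightarrow> real_like x (\<lambda>z. f z - g z)"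
  using real_like_add[OF _ real_like_uminus] by simp

lemma real_like_mult:
  assumes "real_like x f" "real_like x g"
  shows "real_like x (\<lambda>z. f z * g z)"
proof -
  obtain A where A: "A > 0"
    "\<forall>\<^sub>F z in at_nontangential x. 0 < Im z \<and> cmod (f z) \<le> A \<and> \<bar>Im (f z)\<bar> \<le> A * Im z"
    using real_likeE[OF assms(1)] .
  obtain B where B: "B > 0"
    "\<forall>\<^sub>F z in at_nontangential x. 0 < Im z \<and> cmod (g z) \<le> B \<and> \<bar>Im (g z)\<bar> \<le> B * Im z"
    using real_likeE[OF assms(2)] .
  have "\<forall>\<^sub>F z in at_nontangential x. cmod (f z * g z) \<le> 2 * A * B \<and> \<bar>Im (f z * g z)\<bar> \<le> 2 * A * B * Im z"
    using A(2) B(2)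
  proof eventually_elim
    case (elim z)
    have "cmod (f z * g z) \<le> A * B"
      unfolding norm_mult using elim A by (intro mult_mono) auto
    moreover have "0 < A * B" using A(1) B(1) by simp
    moreover have "\<bar>Re (f z)\<bar> * \<bar>Im (g z)\<bar> \<le> A * (B * Im z)"
      using elim A abs_Re_le_cmod[of "f z"] by (intro mult_mono) auto
    moreover have "\<bar>Im (f z)\<bar> * \<bar>Re (g z)\<bar> \<le> (A * Im z) * B"
      using elim A abs_Re_le_cmod[of "g z"] by (intro mult_mono) auto
    ultimately show ?case
      using abs_triangle_ineq[of "Re (f z) * Im (g z)" "Im (f z) * Re (g z)"]
      by (simp add: abs_mult algebra_simps)
  qed
  then show ?thesis unfolding real_like_def by blast
qed

lemma real_like_sum:
  "(\<And>k. k \<in> A \<Longrightarrow> real_like x (f k)) \<Longrightarrow> real_like x (\<lambda>z. \<Sum>k\<in>A. f k z)"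
  by (induction A rule: infinite_finite_induct)
    (use real_like_const[of x 0] in \<open>auto intro: real_like_add\<close>)

lemma real_like_inverse_node:
  assumes "y \<noteq> x"
  shows "real_like x (\<lambda>z. 1 / (z - of_real y))"
proof -
  have "((\<lambda>z. 1 / (z - of_real y)) \<longlongrightarrow> 1 / (of_real x - of_real y)) (at_nontangential x)"
    using assms by (intro tendsto_intros tendsto_at_nontangential_ident) auto
  then have "\<forall>\<^sub>F z in at_nontangential x. cmod (1 / (z - of_real y)) < cmod (1 / (of_real x - of_real y)) + 1"
    by (intro order_tendstoD(2)[OF tendsto_norm]) auto
  then obtain B where B: "\<forall>\<^sub>F z in at_nontangential x. cmod (1 / (z - of_real y)) < B"
    by blast
  \<comment> \<open>The square enters because Im (1/(z - y)) = - Im z |1/(z - y)|^2.\<close>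
  have "\<forall>\<^sub>F z in at_nontangential x. cmod (1 / (z - of_real y)) \<le> max B (B\<^sup>2)
      \<and> \<bar>Im (1 / (z - of_real y))\<bar> \<le> max B (B\<^sup>2) * Im z"
    using B eventually_at_nontangential_Im
  proof eventually_elim
    case (elim z)
    have "Im (1 / (z - of_real y)) = - (Im z * (cmod (1 / (z - of_real y)))\<^sup>2)"
      unfolding norm_divide power_divide cmod_power2 by (simp add: Im_divide)
    then have "\<bar>Im (1 / (z - of_real y))\<bar> = (cmod (1 / (z - of_real y)))\<^sup>2 * Im z"
      using elim by (simp add: abs_mult)
    also have "\<dots> \<le> B\<^sup>2 * Im z"
      using elim by (intro mult_right_mono power_mono) auto
    also have "\<dots> \<le> max B (B\<^sup>2) * Im z"
      using elim by (intro mult_right_mono) auto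
    finally show ?case using elim by simp
  qed
  then show ?thesis unfolding real_like_def by blast
qed

text \<open>
  If \<open>(\<alpha> f + \<beta>) / (\<gamma> f + \<delta>)\<close> with coefficients that are real on the real axis tends to \<open>0\<close>
  while its numerator does not, then \<open>f\<close> tends to \<open>\<infinity>\<close>, and up to bounded terms the kernel of the
  quotient is a positive multiple of the kernel of \<open>-1/f\<close>.
\<close>

lemma moebius_kernel_at_top:
  assumes f: "nevanlinna f"
    and inf: "\<And>\<epsilon>. \<epsilon> > 0 \<Longrightarrow> \<exists>z\<in>upper_half_plane. Im (f z) * (cmod (z - of_real x))\<^sup>2 < \<epsilon> * Im z"
    and real: "real_like x \<alpha>" "real_like x \<beta>" "real_like x \<gamma>" "real_like x \<delta>"
    and lims: "(\<alpha> \<longlongrightarrow> 0) F" "(\<beta> \<longlongrightarrow> of_real \<beta>0) F" "(\<gamma> \<longlongrightarrow> of_real \<gamma>0) F" "(\<delta> \<longlongrightarrow> \<delta>0) F"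
    and F: "F = at_nontangential x"
    and det: "\<beta>0 * \<gamma>0 < 0"
    and N: "((\<lambda>z. \<alpha> z * f z + \<beta> z) \<longlongrightarrow> N0) F" "N0 \<noteq> 0"
    and nz: "\<forall>\<^sub>F z in F. \<gamma> z * f z + \<delta> z \<noteq> 0"
    and lim: "((\<lambda>z. (\<alpha> z * f z + \<beta> z) / (\<gamma> z * f z + \<delta> z)) \<longlongrightarrow> 0) F"
  shows "filterlim (\<lambda>z. Im ((\<alpha> z * f z + \<beta> z) / (\<gamma> z * f z + \<delta> z)) / Im z) at_top F"
proof -
  define E where "E = (\<lambda>z. \<gamma> z * f z + \<delta> z)"
  have \<gamma>0: "\<gamma>0 \<noteq> 0" using det by auto
  have N_ev: "\<forall>\<^sub>F z in F. \<alpha> z * f z + \<beta> z \<noteq> 0"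
    using N by (rule tendsto_imp_eventually_ne)
  \<comment> \<open>The quotient tends to 0 although its numerator does not, so the denominator
    \<open>E\<close> tends to infinity, and so does \<open>f\<close>, recovered as (E -
    \<delta>)/\<gamma>.\<close>
  have "((\<lambda>z. (\<alpha> z * f z + \<beta> z) / E z / (\<alpha> z * f z + \<beta> z)) \<longlongrightarrow> 0 / N0) F"
    unfolding E_def by (intro tendsto_divide lim N)
  moreover have cancel: "n / v / n = inverse v" if "n \<noteq> 0" for n v :: complex
    using that by (simp add: field_simps)
  have "\<forall>\<^sub>F z in F. (\<alpha> z * f z + \<beta> z) / E z / (\<alpha> z * f z + \<beta> z) = inverse (E z)"
    using N_ev by eventually_elim (rule cancel)
  ultimately have "((\<lambda>z. inverse (E z)) \<longlongrightarrow> 0) F"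
    by (simp add: tendsto_cong)
  moreover have "\<forall>\<^sub>F z in F. inverse (E z) \<noteq> 0"
    using nz by eventually_elim (simp add: E_def)
  ultimately have "filterlim (\<lambda>z. inverse (E z)) (at 0) F"
    by (simp add: filterlim_at)
  from filterlim_compose[OF filterlim_inverse_at_infinity this]
  have E_inf: "filterlim E at_infinity F" by simp
  have "filterlim (\<lambda>z. - \<delta> z + E z) at_infinity F"
    by (intro tendsto_add_filterlim_at_infinity[OF tendsto_minus[OF lims(4)]] E_inf)
  then have "filterlim (\<lambda>z. inverse (\<gamma> z) * (- \<delta> z + E z)) at_infinity F"
    using \<gamma>0 by (intro tendsto_mult_filterlim_at_infinity[OF tendsto_inverse[OF lims(3)]]) auto
  moreover have \<gamma>_ev: "\<forall>\<^sub>F z in F. \<gamma> z \<noteq> 0"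
    using \<gamma>0 by (intro tendsto_imp_eventually_ne[OF lims(3)]) simp
  then have "\<forall>\<^sub>F z in F. inverse (\<gamma> z) * (- \<delta> z + E z) = f z"
    by eventually_elim (simp add: E_def)
  ultimately have f_inf: "filterlim f at_infinity F"
    by (simp add: filterlim_cong[OF refl refl])
  define K where "K = (\<lambda>z. Im (f z) / (Im z * (cmod (f z))\<^sup>2))"
  have K: "filterlim K at_top F"
    unfolding K_def F by (rule nontangential_kernel_at_top[OF f inf f_inf[unfolded F]])
  \<comment> \<open>Expanding the imaginary part of (\<alpha> f + \<beta>) times the conjugate of
    \<open>E\<close> and dividing by |f|^2 Im z leaves \<open>Re (X - Y) * K\<close>, the only
    unbounded term, and \<open>S\<close>, which is bounded because the coefficients are
    \<open>real_like\<close> and |f| \<ge> 1 eventually.\<close>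
  define X where "X = (\<lambda>z. \<alpha> z * cnj (\<delta> z))"
  define Y where "Y = (\<lambda>z. \<beta> z * cnj (\<gamma> z))"
  define S where "S = (\<lambda>z. Im (\<alpha> z * cnj (\<gamma> z)) / Im z + Re (f z) / (cmod (f z))\<^sup>2 * (Im (X z + Y z) / Im z)
      + Im (\<beta> z * cnj (\<delta> z)) / Im z / (cmod (f z))\<^sup>2)"
  \<comment> \<open>The limit is that of the determinant \<alpha> \<delta> - \<beta> \<gamma>, since
    \<alpha> tends to 0; its positivity fixes the sign of the divergence.\<close>
  have R: "((\<lambda>z. Re (X z - Y z)) \<longlongrightarrow> - \<beta>0 * \<gamma>0) F"
  proof -
    have "((\<lambda>z. Re (X z - Y z)) \<longlongrightarrow> Re (0 * cnj \<delta>0 - of_real \<beta>0 * cnj (of_real \<gamma>0))) F"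
      unfolding X_def Y_def by (intro tendsto_intros lims)
    then show ?thesis by simp
  qed
  have Im_bounded: "\<exists>B\<ge>0. \<forall>\<^sub>F z in F. \<bar>Im (g z) / Im z\<bar> \<le> B" if g: "real_like x g" for g
  proof -
    obtain B where "B > 0" "\<forall>\<^sub>F z in F. 0 < Im z \<and> cmod (g z) \<le> B \<and> \<bar>Im (g z)\<bar> \<le> B * Im z"
      using real_likeE[OF g] F by blast
    then show ?thesis
      by (intro exI[of _ B]) (auto elim!: eventually_mono simp: divide_simps)
  qed
  have rl: "real_like x (\<lambda>z. \<alpha> z * cnj (\<gamma> z))" "real_like x (\<lambda>z. X z + Y z)"
    "real_like x (\<lambda>z. \<beta> z * cnj (\<delta> z))"
    unfolding X_def Y_def by (intro real_like_mult real_like_add real_like_cnj real)+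
  obtain B1 where B1: "B1 \<ge> 0" "\<forall>\<^sub>F z in F. \<bar>Im (\<alpha> z * cnj (\<gamma> z)) / Im z\<bar> \<le> B1"
    using Im_bounded[OF rl(1)] by blast
  obtain B2 where B2: "B2 \<ge> 0" "\<forall>\<^sub>F z in F. \<bar>Im (X z + Y z) / Im z\<bar> \<le> B2"
    using Im_bounded[OF rl(2)] by blast
  obtain B3 where B3: "B3 \<ge> 0" "\<forall>\<^sub>F z in F. \<bar>Im (\<beta> z * cnj (\<delta> z)) / Im z\<bar> \<le> B3"
    using Im_bounded[OF rl(3)] by blast
  have f_ev: "\<forall>\<^sub>F z in F. cmod (f z) \<ge> 1"
    using f_inf by (auto simp: filterlim_at_infinity_conv_norm_at_top filterlim_at_top)
  have S: "\<forall>\<^sub>F z in F. S z \<ge> - (B1 + B2 + B3)"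
    using B1(2) B2(2) B3(2) f_ev
  proof eventually_elim
    case (elim z)
    have f1: "1 \<le> (cmod (f z))\<^sup>2" using elim by simp
    have "\<bar>Re (f z)\<bar> \<le> cmod (f z) * cmod (f z)"
      using abs_Re_le_cmod[of "f z"] elim mult_left_mono[of 1 "cmod (f z)" "cmod (f z)"] by simp
    then have "\<bar>Re (f z) / (cmod (f z))\<^sup>2\<bar> \<le> 1"
      using f1 by (simp add: abs_divide divide_simps power2_eq_square)
    then have "\<bar>Re (f z) / (cmod (f z))\<^sup>2 * (Im (X z + Y z) / Im z)\<bar> \<le> 1 * B2"
      unfolding abs_mult using elim by (intro mult_mono) auto
    moreover have "\<bar>Im (\<beta> z * cnj (\<delta> z)) / Im z / (cmod (f z))\<^sup>2\<bar> \<le> B3 / 1"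
      unfolding abs_divide[of _ "(cmod (f z))\<^sup>2"] using elim f1 B3(1) by (intro frac_le) auto
    ultimately show ?case
      using elim unfolding S_def by linarith
  qed
  have "filterlim (\<lambda>z. Re (X z - Y z) * K z) at_top F"
    using det by (intro filterlim_tendsto_pos_mult_at_top[OF R _ K]) simp
  then have "filterlim (\<lambda>z. - (B1 + B2 + B3) + Re (X z - Y z) * K z) at_top F"
    by (rule filterlim_tendsto_add_at_top[OF tendsto_const])
  moreover have "\<forall>\<^sub>F z in F. - (B1 + B2 + B3) + Re (X z - Y z) * K z \<le> S z + Re (X z - Y z) * K z"
    using S by eventually_elim simp
  ultimately have SK: "filterlim (\<lambda>z. S z + Re (X z - Y z) * K z) at_top F"
    by (rule filterlim_at_top_mono)
  \<comment> \<open>The remaining factor |f|^2 / |\<gamma> f + \<delta>|^2 has the positive limit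
    1/\<gamma>0^2.\<close>
  have "((\<lambda>z. \<gamma> z + \<delta> z / f z) \<longlongrightarrow> of_real \<gamma>0 + 0) F"
    by (intro tendsto_intros lims tendsto_divide_0[OF lims(4)] f_inf)
  from tendsto_inverse[OF tendsto_power[OF tendsto_norm[OF this], of 2]]
  have "((\<lambda>z. inverse ((cmod (\<gamma> z + \<delta> z / f z))\<^sup>2)) \<longlongrightarrow> inverse ((cmod (of_real \<gamma>0 + 0))\<^sup>2)) F"
    using \<gamma>0 by simp
  from filterlim_tendsto_pos_mult_at_top[OF this _ SK]
  have "filterlim (\<lambda>z. inverse ((cmod (\<gamma> z + \<delta> z / f z))\<^sup>2) * (S z + Re (X z - Y z) * K z)) at_top F"
    using \<gamma>0 by simp
  moreover have "\<forall>\<^sub>F z in F. inverse ((cmod (\<gamma> z + \<delta> z / f z))\<^sup>2) * (S z + Re (X z - Y z) * K z)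
      = Im ((\<alpha> z * f z + \<beta> z) / (\<gamma> z * f z + \<delta> z)) / Im z"
    using f_ev nz eventually_at_nontangential_Im[of x, folded F]
  proof eventually_elim
    case (elim z)
    have f0: "f z \<noteq> 0" using elim by auto
    define n where "n = (cmod (f z))\<^sup>2"
    have n: "n > 0" using f0 by (simp add: n_def)
    have fold_E: "\<gamma> z * f z + \<delta> z = E z" by (simp add: E_def)
    have n_eq: "n = Re (f z) * Re (f z) + Im (f z) * Im (f z)"
      unfolding n_def cmod_power2 by (simp add: power2_eq_square)
    define T where "T = Im ((\<alpha> z * f z + \<beta> z) * cnj (E z))"
    have T: "T = n * Im (\<alpha> z * cnj (\<gamma> z)) + Im (f z) * Re (X z - Y z)
        + Re (f z) * Im (X z + Y z) + Im (\<beta> z * cnj (\<delta> z))"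
      unfolding T_def E_def X_def Y_def n_eq by (simp add: algebra_simps)
    have "\<gamma> z + \<delta> z / f z = E z / f z"
      using f0 by (simp add: E_def field_simps)
    then have 1: "inverse ((cmod (\<gamma> z + \<delta> z / f z))\<^sup>2) = n / (cmod (E z))\<^sup>2"
      by (simp add: norm_divide power_divide n_def)
    have 2: "S z + Re (X z - Y z) * K z = T / (n * Im z)"
      unfolding S_def K_def n_def[symmetric] T using n elim
      by (simp add: field_simps)
    have "Im ((\<alpha> z * f z + \<beta> z) / E z) = T / (cmod (E z))\<^sup>2"
      unfolding T_def complex_div_cnj[of "\<alpha> z * f z + \<beta> z" "E z"]
      by (simp only: Im_divide_of_real of_real_power[symmetric])
    then show ?case
      unfolding 1 2 fold_E using n elim by (simp add: divide_simps)
  qed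
  ultimately show ?thesis
    by (simp add: filterlim_cong[OF refl refl])
qed

section \<open>The matrix function of the Pick problem\<close>

lemma matrix_inv_invertible:
  assumes "invertible A"
  shows "A ** matrix_inv A = mat 1" "matrix_inv A ** A = mat 1"
  using someI_ex[OF assms[unfolded invertible_def]] by (simp_all add: matrix_inv_def)

lemma matrix_inv_unique:
  assumes "A ** B = mat 1" "B ** A = mat 1"
  shows "matrix_inv A = B"
proof -
  have "invertible A" using assms by (auto simp: invertible_def)
  then have "matrix_inv A ** A ** B = B"
    by (simp add: matrix_inv_invertible)
  then show ?thesis
    unfolding matrix_mul_assoc[symmetric] assms(1) by simp
qed

lemma matrix_inv_node_matrix:
  assumes "\<And>k. z \<noteq> complex_of_real (x k)"
  shows "matrix_inv (mat z - complex_matrix (node_matrix x)) =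
    (\<chi> k j. if k = j then 1 / (z - of_real (x k)) else 0)"
proof -
  have eq: "mat z - complex_matrix (node_matrix x) = (\<chi> k j. if k = j then z - of_real (x k) else 0)"
    by (simp add: vec_eq_iff mat_def complex_matrix_def node_matrix_def)
  show ?thesis
    unfolding eq using assms
    by (intro matrix_inv_unique) (simp_all add: vec_eq_iff matrix_matrix_mult_def mat_def
        if_distrib[of "\<lambda>u. u * _"] if_distrib[of "\<lambda>u. _ * u"] cong: if_cong)
qed

locale pick_problem =
  fixes L :: "'n::finite set" and x w \<gamma> \<xi> :: "'n \<Rightarrow> real"
  assumes data: "interpolation_data L x \<xi>"
    and inv: "invertible (pick_matrix L x w \<gamma> \<xi>)"
begin

abbreviation "P \<equiv> pick_matrix L x w \<gamma> \<xi>"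
abbreviation "Q \<equiv> matrix_inv P"
abbreviation "C \<equiv> C_row L w \<xi>"
abbreviation "E \<equiv> E_row L :: real^'n"
abbreviation "c k \<equiv> (C v* Q) $ k"
abbreviation "e k \<equiv> (E v* Q) $ k"

lemma inj_x: "x j = x k \<longleftrightarrow> j = k"
  using data by (auto simp: interpolation_data_def inj_def)

lemma P_sym: "P $ j $ k = P $ k $ j"
proof -
  have "(w k - w j) / (x k - x j) = (w j - w k) / (x j - x k)"
    using minus_divide_divide[of "w j - w k" "x j - x k"] by simp
  then show ?thesis by (auto simp: pick_matrix_def)
qed

lemma Q_sym: "Q $ j $ k = Q $ k $ j"
proof -
  have "transpose P = P" by (simp add: vec_eq_iff transpose_def P_sym)
  then have "P ** transpose Q = mat 1" "transpose Q ** P = mat 1"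
    using matrix_inv_invertible[OF inv] by (metis matrix_transpose_mul transpose_mat)+
  then have "Q = transpose Q" by (rule matrix_inv_unique)
  then have "Q $ j $ k = transpose Q $ j $ k" by simp
  then show ?thesis by (simp add: transpose_def)
qed

lemma P_Q: "(\<Sum>k\<in>UNIV. P $ j $ k * Q $ k $ l) = (if j = l then 1 else 0)"
  and Q_P: "(\<Sum>k\<in>UNIV. Q $ j $ k * P $ k $ l) = (if j = l then 1 else 0)"
  using matrix_inv_invertible[OF inv]
  by (simp_all add: vec_eq_iff matrix_matrix_mult_def mat_def)

lemma c_eq: "c k = (\<Sum>j\<in>UNIV. Q $ k $ j * C $ j)"
  and e_eq: "e k = (\<Sum>j\<in>UNIV. Q $ k $ j * E $ j)"
  by (simp_all add: vector_matrix_mult_def Q_sym[of k] mult.commute)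

lemma P_vec: "P *v (v v* Q) = v"
proof -
  have "transpose Q = Q" by (simp add: vec_eq_iff transpose_def Q_sym)
  then have "v v* Q = Q *v v" by (metis vector_transpose_matrix)
  then show ?thesis by (simp add: matrix_vector_mul_assoc matrix_inv_invertible[OF inv])
qed

lemma P_c: "(\<Sum>k\<in>UNIV. P $ j $ k * c k) = C $ j"
  and P_e: "(\<Sum>k\<in>UNIV. P $ j $ k * e k) = E $ j"
  using P_vec[of C] P_vec[of E] by (simp_all add: vec_eq_iff matrix_vector_mult_def)

text \<open>Entrywise form of P X - X P = E^T C - C^T E with the diagonal node matrix X, the
  structure from which all evaluations at the node follow.\<close>

lemma lyapunov: "P $ j $ k * (x k - x j) = E $ j * C $ k - C $ j * E $ k"
proof (cases "j = k")
  case False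
  then have *: "u / (x k - x j) * (x k - x j) = u" "u / (x j - x k) * (x k - x j) = - u" for u
    using inj_x[of j k] by (simp_all add: divide_simps) (simp_all add: algebra_simps)
  show ?thesis
    using False by (cases "j \<in> L"; cases "k \<in> L") (simp_all add: pick_matrix_def C_row_def E_row_def * inj_x del: times_divide_eq_left)
qed simp

text \<open>Multiplying the Lyapunov identity by Q on both sides turns P X - X P into X Q - Q X;
  \<open>S\<close> is an entry of this product computed in two ways.\<close>

lemma lyapunov_inverse: "Q $ k $ j * (x k - x j) = e k * c j - c k * e j"
proof -
  define S where "S = (\<Sum>a\<in>UNIV. \<Sum>b\<in>UNIV. Q $ k $ a * (P $ a $ b * (x b - x a)) * Q $ b $ j)"
  have "S = (\<Sum>a\<in>UNIV. \<Sum>b\<in>UNIV. Q $ k $ a * P $ a $ b * (x b * Q $ b $ j))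
      - (\<Sum>a\<in>UNIV. \<Sum>b\<in>UNIV. Q $ k $ a * x a * (P $ a $ b * Q $ b $ j))"
    unfolding S_def sum_subtractf[symmetric]
    by (intro sum.cong refl) (simp add: algebra_simps)
  also have "(\<Sum>a\<in>UNIV. \<Sum>b\<in>UNIV. Q $ k $ a * P $ a $ b * (x b * Q $ b $ j))
      = (\<Sum>b\<in>UNIV. (\<Sum>a\<in>UNIV. Q $ k $ a * P $ a $ b) * (x b * Q $ b $ j))"
    unfolding sum_distrib_right by (rule sum.swap)
  also have "\<dots> = x k * Q $ k $ j"
    unfolding Q_P by (simp add: if_distrib[of "\<lambda>u. u * _"] cong: if_cong)
  also have "(\<Sum>a\<in>UNIV. \<Sum>b\<in>UNIV. Q $ k $ a * x a * (P $ a $ b * Q $ b $ j))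
      = (\<Sum>a\<in>UNIV. Q $ k $ a * x a * (if a = j then 1 else 0))"
    unfolding sum_distrib_left[symmetric] P_Q ..
  also have "\<dots> = Q $ k $ j * x j"
    by (simp add: if_distrib[of "\<lambda>u. _ * u"] cong: if_cong)
  finally have 1: "S = Q $ k $ j * (x k - x j)"
    by (simp add: algebra_simps)
  have "S = (\<Sum>a\<in>UNIV. \<Sum>b\<in>UNIV. (Q $ k $ a * E $ a) * (Q $ j $ b * C $ b))
      - (\<Sum>a\<in>UNIV. \<Sum>b\<in>UNIV. (Q $ k $ a * C $ a) * (Q $ j $ b * E $ b))"
    unfolding S_def lyapunov sum_subtractf[symmetric] Q_sym[of _ j]
    by (intro sum.cong refl) (simp add: algebra_simps)
  then have "S = e k * c j - c k * e j"
    unfolding sum_product[symmetric] c_eq e_eq .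
  with 1 show ?thesis by simp
qed

lemma Theta_entries:
  assumes z: "0 < Im z"
  shows "Theta L x w \<gamma> \<xi> z $ 1 $ 1 = 1 + (\<Sum>k\<in>UNIV. of_real (C $ k * e k) / (z - of_real (x k)))"
    "Theta L x w \<gamma> \<xi> z $ 1 $ 2 = - (\<Sum>k\<in>UNIV. of_real (C $ k * c k) / (z - of_real (x k)))"
    "Theta L x w \<gamma> \<xi> z $ 2 $ 1 = (\<Sum>k\<in>UNIV. of_real (E $ k * e k) / (z - of_real (x k)))"
    "Theta L x w \<gamma> \<xi> z $ 2 $ 2 = 1 - (\<Sum>k\<in>UNIV. of_real (E $ k * c k) / (z - of_real (x k)))"
proof -
  define CE where "CE = complex_matrix (vector [C, E] :: real^'n^2)"
  define R where "R = matrix_inv (mat z - complex_matrix (node_matrix x))"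
  define M where "M = CE ** R ** complex_matrix Q ** transpose CE"
  have "R = (\<chi> k j. if k = j then 1 / (z - of_real (x k)) else 0)"
    unfolding R_def by (rule matrix_inv_node_matrix) (use z in auto)
  then have "(CE ** R) $ r $ k = CE $ r $ k / (z - of_real (x k))" for r k
    by (simp add: matrix_matrix_mult_def if_distrib[of "\<lambda>u. _ * u"] cong: if_cong)
  moreover have "(complex_matrix Q ** transpose CE) $ k $ 1 = of_real (c k)"
    "(complex_matrix Q ** transpose CE) $ k $ 2 = of_real (e k)" for k
    by (simp_all add: matrix_matrix_mult_def transpose_def CE_def complex_matrix_def c_eq e_eq)
  ultimately have M: "M $ r $ 1 = (\<Sum>k\<in>UNIV. CE $ r $ k / (z - of_real (x k)) * of_real (c k))"
    "M $ r $ 2 = (\<Sum>k\<in>UNIV. CE $ r $ k / (z - of_real (x k)) * of_real (e k))" for r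
    unfolding M_def matrix_mul_assoc[symmetric, of "CE ** R"]
    by (simp_all add: matrix_matrix_mult_def[of "CE ** R"])
  have T: "Theta L x w \<gamma> \<xi> z = mat 1 - mat \<i> ** (M ** J_matrix)"
    unfolding Theta_def Let_def M_def CE_def R_def ..
  have ii: "\<i> * (m * \<i>) = - m" for m
    by (simp add: complex_eq_iff)
  \<comment> \<open>Together with the outer minus sign, columns (m1, m2) become (m2, -m1): the first
    column of \<Theta> carries \<open>e\<close>, the second carries \<open>c\<close>.\<close>
  have MJ: "(mat \<i> ** (M ** J_matrix)) $ r $ 1 = - (M $ r $ 2)"
    "(mat \<i> ** (M ** J_matrix)) $ r $ 2 = M $ r $ 1" for r
    using exhaust_2[of r] by (auto simp: matrix_matrix_mult_def sum_2 J_matrix_def mat_def ii)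
  show "Theta L x w \<gamma> \<xi> z $ 1 $ 1 = 1 + (\<Sum>k\<in>UNIV. of_real (C $ k * e k) / (z - of_real (x k)))"
    "Theta L x w \<gamma> \<xi> z $ 1 $ 2 = - (\<Sum>k\<in>UNIV. of_real (C $ k * c k) / (z - of_real (x k)))"
    "Theta L x w \<gamma> \<xi> z $ 2 $ 1 = (\<Sum>k\<in>UNIV. of_real (E $ k * e k) / (z - of_real (x k)))"
    "Theta L x w \<gamma> \<xi> z $ 2 $ 2 = 1 - (\<Sum>k\<in>UNIV. of_real (E $ k * c k) / (z - of_real (x k)))"
    unfolding T vector_minus_component MJ
    by (simp_all add: M CE_def complex_matrix_def mat_def)
qed

end

section \<open>Behaviour at a node\<close>

lemma boundary_residue_Fin_iff:
  assumes "((\<lambda>z. (z - of_real x) * \<phi> z) \<longlongrightarrow> of_real r) (at_nontangential x)"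
  shows "has_boundary_residue (Fin \<phi>) x m \<longleftrightarrow> m = ereal r"
proof -
  have "\<not> filterlim (\<lambda>z. (z - of_real x) * \<phi> z) at_infinity (at_nontangential x)"
    using assms not_tendsto_and_filterlim_at_infinity[OF at_nontangential_neq_bot] by blast
  moreover have "r' = r" if "((\<lambda>z. (z - of_real x) * \<phi> z) \<longlongrightarrow> of_real r') (at_nontangential x)" for r'
    using tendsto_unique[OF at_nontangential_neq_bot that assms] by simp
  ultimately show ?thesis
    using assms unfolding has_boundary_residue.simps by blast
qed

lemma residue_nonzero_imp_infinite:
  assumes "((\<lambda>z. (z - of_real x) * \<phi> z) \<longlongrightarrow> r) (at_nontangential x)" "r \<noteq> 0"
  shows "filterlim \<phi> at_infinity (at_nontangential x)"
proof -
  have ne: "\<forall>\<^sub>F z in at_nontangential x. z - of_real x \<noteq> 0"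
    using eventually_at_nontangential_Im[of x] by eventually_elim auto
  then have "filterlim (\<lambda>z. z - of_real x) (at 0) (at_nontangential x)"
    using tendsto_at_nontangential_minus by (simp add: filterlim_at)
  from filterlim_compose[OF filterlim_inverse_at_infinity this]
  have "filterlim (\<lambda>z. (z - of_real x) * \<phi> z * inverse (z - of_real x)) at_infinity (at_nontangential x)"
    by (intro tendsto_mult_filterlim_at_infinity[OF assms])
  then show ?thesis
    by (rule filterlim_cong[OF refl refl, THEN iffD1, rotated])
      (use ne in eventually_elim, simp)
qed

lemma one_divide_ereal: "1 / ereal r = (if r = 0 then \<infinity> else ereal (1 / r))"
proof -
  have "1 / ereal r = ereal 1 / ereal r" by (simp only: one_ereal_def)
  then show ?thesis by simp
qed

lemma neg_recip_minus: "m > 0 \<Longrightarrow> neg_recip (ereal (- m)) = ereal (1 / m)"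
  unfolding neg_recip_def one_divide_ereal by simp

text \<open>The residue is -m, so \<open>neg_recip\<close> gives 1/m when m > 0. For m = 0 both
  \<open>neg_recip\<close> and the reciprocal in \<open>ereal\<close> are infinite, which rules out
  the third to sixth conditions; the sixth needs an infinite residue and never holds for a finite
  parameter.\<close>

lemma cond_Fin:
  assumes lim: "((\<lambda>z. (z - of_real x) * \<phi> z) \<longlongrightarrow> of_real (- m)) (at_nontangential x)"
    and m: "m \<ge> 0" and c: "c \<noteq> 0"
  shows "cond1 (Fin \<phi>) x \<or> cond2 (Fin \<phi>) x \<longleftrightarrow> m = 0"
    "cond3 p c (Fin \<phi>) x \<longleftrightarrow> m > 0 \<and> c\<^sup>2 + p * m > 0"
    "cond4 p c (Fin \<phi>) x \<longleftrightarrow> m > 0 \<and> c\<^sup>2 + p * m < 0"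
    "cond5 p c (Fin \<phi>) x \<Longrightarrow> c\<^sup>2 + p * m = 0"
    "\<not> cond6 p (Fin \<phi>) x"
proof -
  note res = boundary_residue_Fin_iff[OF lim]
  have inf: "has_boundary_value (Fin \<phi>) x Infty" if "m > 0"
    using residue_nonzero_imp_infinite[OF lim] that by simp
  have c2: "c\<^sup>2 > 0" using c by simp
  have m0: "neg_recip (ereal (- m)) = \<infinity>" if "\<not> m > 0"
    using that m by (simp add: neg_recip_def)
  show "cond1 (Fin \<phi>) x \<or> cond2 (Fin \<phi>) x \<longleftrightarrow> m = 0"
    using inf m by (cases "m = 0") (auto simp: cond1_def cond2_def res simp del: has_boundary_value.simps has_boundary_residue.simps)
  have less: "- p / c\<^sup>2 < 1 / m \<longleftrightarrow> c\<^sup>2 + p * m > 0" "1 / m < - p / c\<^sup>2 \<longleftrightarrow> c\<^sup>2 + p * m < 0" if "m > 0"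
    using that c2 by (auto simp: field_simps)
  show "cond3 p c (Fin \<phi>) x \<longleftrightarrow> m > 0 \<and> c\<^sup>2 + p * m > 0"
    using inf m0 less by (cases "m > 0") (auto simp: cond3_def res neg_recip_minus simp del: has_boundary_value.simps has_boundary_residue.simps)
  show "cond4 p c (Fin \<phi>) x \<longleftrightarrow> m > 0 \<and> c\<^sup>2 + p * m < 0"
    using inf m0 less by (cases "m > 0") (auto simp: cond4_def res neg_recip_minus simp del: has_boundary_value.simps has_boundary_residue.simps)
  have recip: "1 / ereal (- m) = (if m = 0 then \<infinity> else ereal (- 1 / m))"
    unfolding one_divide_ereal by simp
  show "c\<^sup>2 + p * m = 0" if "cond5 p c (Fin \<phi>) x"
  proof -
    have "1 / ereal (- m) = ereal (p / c\<^sup>2)"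
      using that by (auto simp: cond5_def res simp del: has_boundary_value.simps has_boundary_residue.simps)
    then have "m \<noteq> 0" "- 1 / m = p / c\<^sup>2"
      unfolding recip by (auto split: if_splits)
    then show ?thesis using c2 by (simp add: field_simps)
  qed
  show "\<not> cond6 p (Fin \<phi>) x"
    using recip by (auto simp: cond6_def res simp del: has_boundary_value.simps has_boundary_residue.simps split: if_splits)
qed

text \<open>The residue is infinite and its reciprocal 0, so only the sign of \<open>p\<close> is
  left to compare.\<close>

lemma cond_Infty:
  assumes "c \<noteq> 0"
  shows "\<not> cond1 Infty x" "\<not> cond2 Infty x"
    "cond3 p c Infty x \<longleftrightarrow> p > 0" "cond4 p c Infty x \<longleftrightarrow> p < 0"
    "\<not> cond5 p c Infty x" "cond6 p Infty x \<Longrightarrow> p = 0"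
  using assms by (auto simp: cond1_def cond2_def cond3_def cond4_def cond5_def cond6_def neg_recip_def
      divide_less_0_iff zero_less_divide_iff)

section \<open>Local form of \<Theta> at a node with e_i = 0\<close>

locale regular_node = pick_problem L x w \<gamma> \<xi>
  for L :: "'n::finite set" and x w \<gamma> \<xi> :: "'n \<Rightarrow> real" +
  fixes i :: 'n
  assumes i: "i \<in> L" and e0: "e i = 0"
begin

abbreviation "t z \<equiv> z - complex_of_real (x i)"

definition partial_fraction :: "('n \<Rightarrow> real) \<Rightarrow> complex \<Rightarrow> complex" where
  "partial_fraction u z = (\<Sum>k\<in>-{i}. of_real (u k) / (z - of_real (x k)))"

text \<open>
  The entries of \<open>\<Theta>\<close> with their pole at \<open>x\<^sub>i\<close> split off: \<open>\<Theta>\<^sub>2\<^sub>1 = g\<close>, \<open>\<Theta>\<^sub>1\<^sub>1 = w\<^sub>i g + t a\<close>,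
  \<open>t \<Theta>\<^sub>2\<^sub>2 = h\<close>, \<open>\<Theta>\<^sub>1\<^sub>2 = w\<^sub>i \<Theta>\<^sub>2\<^sub>2 + b\<close>; moreover \<open>s\<close> is the difference quotient of \<open>g\<close> at \<open>x\<^sub>i\<close>.
\<close>

definition coeff_a :: "complex \<Rightarrow> complex" where
  "coeff_a z = partial_fraction (\<lambda>k. P $ i $ k * e k) z"

definition coeff_b :: "complex \<Rightarrow> complex" where
  "coeff_b z = - of_real (w i) - partial_fraction (\<lambda>k. P $ i $ k * (x k - x i) * c k) z"

definition coeff_g :: "complex \<Rightarrow> complex" where
  "coeff_g z = partial_fraction (\<lambda>k. E $ k * e k) z"

definition coeff_s :: "complex \<Rightarrow> complex" where
  "coeff_s z = - partial_fraction (\<lambda>k. E $ k * e k / (x i - x k)) z"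

definition coeff_h :: "complex \<Rightarrow> complex" where
  "coeff_h z = t z * (1 - partial_fraction (\<lambda>k. E $ k * c k) z) - of_real (c i)"

lemma sum_split: "(\<Sum>k\<in>UNIV. f k) = f i + (\<Sum>k\<in>-{i}. f k)" for f :: "'n \<Rightarrow> 'b::comm_monoid_add"
  by (subst sum.remove[of _ i]) (auto simp: Compl_eq_Diff_UNIV)

lemma C_i: "C $ i = w i" and E_i: "E $ i = 1" and P_ii: "P $ i $ i = \<gamma> i"
  using i by (simp_all add: C_row_def E_row_def pick_matrix_def)

lemma sum_P_e: "(\<Sum>k\<in>-{i}. P $ i $ k * e k) = 1"
  using P_e[of i] by (simp add: sum_split e0 E_i)

lemma sum_P_c: "(\<Sum>k\<in>-{i}. P $ i $ k * c k) = w i - \<gamma> i * c i"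
  using P_c[of i] by (simp add: sum_split C_i P_ii)

lemma P_node: "P $ i $ k * (x k - x i) = C $ k - w i * E $ k"
  using lyapunov[of i k] by (simp add: C_i E_i)

text \<open>If c_i vanished along with e_i, \<open>lyapunov_inverse\<close> would kill row i of Q
  off the diagonal; then e_i = Q_ii, so the whole row would be 0, impossible for an invertible
  matrix.\<close>

lemma c_nonzero: "c i \<noteq> 0"
proof
  assume c0: "c i = 0"
  have 0: "Q $ i $ k = 0" if "k \<noteq> i" for k
    using lyapunov_inverse[of i k] e0 c0 inj_x[of i k] that by simp
  then have "Q $ i $ i = 0"
    using e0 unfolding e_eq sum_split by (simp add: E_i)
  then have "Q $ i $ k = 0" for k using 0 by (cases "k = i") auto
  then show False using Q_P[of i i] by simp
qed

text \<open>With e_i = 0 the inverse Lyapunov identity reads Q_ik (x_i - x_k) = - c_i e_k. It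
  converts the sums defining \<open>coeff_a\<close> and \<open>coeff_g\<close> at the node into a
  row of P Q = 1 and the formula for e_i.\<close>

lemma e_div:
  assumes "k \<noteq> i"
  shows "e k / (x i - x k) = - Q $ i $ k / c i"
  using lyapunov_inverse[of i k] e0 c_nonzero inj_x[of i k] assms by (simp add: divide_simps mult_ac)

lemma partial_fraction_node:
  "partial_fraction u (of_real (x i)) = of_real (\<Sum>k\<in>-{i}. u k / (x i - x k))"
  by (simp add: partial_fraction_def)

lemma coeff_a_node: "coeff_a (of_real (x i)) = of_real (- (1 - \<gamma> i * Q $ i $ i) / c i)"
proof -
  have "(\<Sum>k\<in>-{i}. P $ i $ k * e k / (x i - x k)) = (\<Sum>k\<in>-{i}. - (P $ i $ k * Q $ k $ i) / c i)"
  proof (intro sum.cong refl)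
    fix k assume "k \<in> - {i}"
    then have "e k / (x i - x k) = - Q $ i $ k / c i"
      by (intro e_div) simp
    then have "P $ i $ k * (e k / (x i - x k)) = P $ i $ k * (- Q $ i $ k / c i)"
      by simp
    then show "P $ i $ k * e k / (x i - x k) = - (P $ i $ k * Q $ k $ i) / c i"
      by (simp add: Q_sym[of i k])
  qed
  also have "\<dots> = - (\<Sum>k\<in>-{i}. P $ i $ k * Q $ k $ i) / c i"
    by (simp add: sum_divide_distrib sum_negf)
  also have "(\<Sum>k\<in>-{i}. P $ i $ k * Q $ k $ i) = 1 - \<gamma> i * Q $ i $ i"
    using P_Q[of i i] by (simp add: sum_split P_ii)
  finally show ?thesis
    by (simp only: coeff_a_def partial_fraction_node)
qed

lemma coeff_b_node: "coeff_b (of_real (x i)) = of_real (- \<gamma> i * c i)"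
proof -
  have "(\<Sum>k\<in>-{i}. P $ i $ k * (x k - x i) * c k / (x i - x k)) = (\<Sum>k\<in>-{i}. - (P $ i $ k * c k))"
  proof (intro sum.cong refl)
    fix k assume "k \<in> - {i}"
    then have "x i - x k \<noteq> 0" using inj_x[of i k] by auto
    then show "P $ i $ k * (x k - x i) * c k / (x i - x k) = - (P $ i $ k * c k)"
      by (simp add: divide_simps) (simp add: algebra_simps)
  qed
  also have "\<dots> = \<gamma> i * c i - w i"
    by (simp add: sum_negf sum_P_c)
  finally show ?thesis
    by (simp only: coeff_b_def partial_fraction_node) simp
qed

lemma coeff_g_node: "coeff_g (of_real (x i)) = of_real (Q $ i $ i / c i)"
proof -
  have "(\<Sum>k\<in>-{i}. E $ k * e k / (x i - x k)) = (\<Sum>k\<in>-{i}. - (Q $ i $ k * E $ k) / c i)"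
  proof (intro sum.cong refl)
    fix k assume "k \<in> - {i}"
    then have "e k / (x i - x k) = - Q $ i $ k / c i"
      by (intro e_div) simp
    then have "E $ k * (e k / (x i - x k)) = E $ k * (- Q $ i $ k / c i)"
      by simp
    then show "E $ k * e k / (x i - x k) = - (Q $ i $ k * E $ k) / c i"
      by simp
  qed
  also have "\<dots> = - (\<Sum>k\<in>-{i}. Q $ i $ k * E $ k) / c i"
    by (simp add: sum_divide_distrib sum_negf)
  also have "(\<Sum>k\<in>-{i}. Q $ i $ k * E $ k) = - Q $ i $ i"
    using e_eq[of i] e0 by (simp add: sum_split E_i)
  finally show ?thesis
    by (simp only: coeff_g_def partial_fraction_node) simp
qed

lemma coeff_h_node: "coeff_h (of_real (x i)) = of_real (- c i)"
  by (simp add: coeff_h_def)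

lemma isCont_partial_fraction: "isCont (partial_fraction u) (of_real (x i))"
  unfolding partial_fraction_def using inj_x by (intro continuous_intros) auto

lemma holomorphic_partial_fraction:
  "partial_fraction u holomorphic_on - of_real ` x ` (- {i})"
  unfolding partial_fraction_def by (intro holomorphic_intros) auto

lemma isCont_coeff:
  "isCont coeff_a (of_real (x i))" "isCont coeff_b (of_real (x i))"
  "isCont coeff_g (of_real (x i))" "isCont coeff_h (of_real (x i))"
  unfolding coeff_a_def coeff_b_def coeff_g_def coeff_h_def
  by (intro continuous_intros isCont_partial_fraction)+

lemma coeff_lim:
  "(coeff_a \<longlongrightarrow> of_real (- (1 - \<gamma> i * Q $ i $ i) / c i)) (at_nontangential (x i))"
  "(coeff_b \<longlongrightarrow> of_real (- \<gamma> i * c i)) (at_nontangential (x i))"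
  "(coeff_g \<longlongrightarrow> of_real (Q $ i $ i / c i)) (at_nontangential (x i))"
  "(coeff_h \<longlongrightarrow> of_real (- c i)) (at_nontangential (x i))"
  by (rule nontangential_isCont isCont_coeff coeff_a_node coeff_b_node coeff_g_node coeff_h_node)+

lemma holomorphic_coeff:
  "coeff_a holomorphic_on upper_half_plane" "coeff_b holomorphic_on upper_half_plane"
  "coeff_g holomorphic_on upper_half_plane" "coeff_h holomorphic_on upper_half_plane"
proof -
  have "partial_fraction u holomorphic_on upper_half_plane" for u
    by (rule holomorphic_on_subset[OF holomorphic_partial_fraction]) (auto simp: upper_half_plane_def)
  then show "coeff_a holomorphic_on upper_half_plane" "coeff_b holomorphic_on upper_half_plane"
    "coeff_g holomorphic_on upper_half_plane" "coeff_h holomorphic_on upper_half_plane"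
    unfolding coeff_a_def coeff_b_def coeff_g_def coeff_h_def
    by (auto intro!: holomorphic_intros)
qed

lemma Theta_node:
  assumes z: "0 < Im z"
  defines "T \<equiv> Theta L x w \<gamma> \<xi> z"
  shows "T $ 2 $ 1 = coeff_g z"
    "T $ 1 $ 1 = of_real (w i) * coeff_g z + t z * coeff_a z"
    "t z * T $ 2 $ 2 = coeff_h z"
    "T $ 1 $ 2 = of_real (w i) * T $ 2 $ 2 + coeff_b z"
proof -
  have ne: "z - of_real (x k) \<noteq> 0" for k using z by (auto simp: complex_eq_iff)
  note T = Theta_entries[OF z, folded T_def]
  show 21: "T $ 2 $ 1 = coeff_g z"
    unfolding T sum_split by (simp add: e0 coeff_g_def partial_fraction_def)
  have PC: "of_real (P $ i $ k) * (of_real (x k) - of_real (x i)) = (of_real (C $ k) - of_real (w i) * of_real (E $ k) :: complex)" for k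
    using P_node[of k] by (metis of_real_diff of_real_mult)
  \<comment> \<open>Writing t = (z - x_k) + (x_k - x_i) splits each term; by \<open>sum_P_e\<close>
    the first parts add up to the constant 1 in \<Theta>_11.\<close>
  have "t z * coeff_a z = (\<Sum>k\<in>-{i}. of_real (P $ i $ k * e k)
      + (of_real (C $ k) - of_real (w i) * of_real (E $ k)) * of_real (e k) / (z - of_real (x k)))"
    unfolding coeff_a_def partial_fraction_def sum_distrib_left PC[symmetric]
    using ne by (intro sum.cong refl) (simp add: divide_simps, simp add: algebra_simps)
  also have "\<dots> = 1 + (\<Sum>k\<in>-{i}. of_real (C $ k * e k) / (z - of_real (x k)))
      - of_real (w i) * coeff_g z"
    unfolding sum.distrib of_real_sum[symmetric] sum_P_e coeff_g_def partial_fraction_def sum_distrib_left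
    by (simp add: algebra_simps sum_subtractf diff_divide_distrib)
  finally show "T $ 1 $ 1 = of_real (w i) * coeff_g z + t z * coeff_a z"
    unfolding T sum_split by (simp add: e0)
  show "t z * T $ 2 $ 2 = coeff_h z"
    unfolding T sum_split coeff_h_def partial_fraction_def
    using ne[of i] by (simp add: E_i field_simps)
  have "partial_fraction (\<lambda>k. P $ i $ k * (x k - x i) * c k) z
      = (\<Sum>k\<in>-{i}. of_real (C $ k * c k) / (z - of_real (x k)))
        - of_real (w i) * (\<Sum>k\<in>-{i}. of_real (E $ k * c k) / (z - of_real (x k)))"
    unfolding partial_fraction_def P_node sum_distrib_left sum_subtractf[symmetric]
    by (intro sum.cong refl) (simp add: algebra_simps diff_divide_distrib)
  then show "T $ 1 $ 2 = of_real (w i) * T $ 2 $ 2 + coeff_b z"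
    unfolding T sum_split coeff_b_def by (simp add: C_i E_i algebra_simps)
qed

section \<open>Boundary values and derivatives of the transform\<close>

abbreviation "p \<equiv> Q $ i $ i"
abbreviation "\<Theta> \<equiv> Theta L x w \<gamma> \<xi>"

text \<open>Multiplication by t clears the pole of \<Theta>_22: with d the original denominator, D =
  t d and the numerator is w_i d + N. As t has no zero in the half plane, D and d vanish
  together.\<close>

lemma lin_frac_Fin:
  assumes "nevanlinna \<phi>"
  defines "N \<equiv> \<lambda>z. coeff_a z * (t z * \<phi> z) + coeff_b z"
    and "D \<equiv> \<lambda>z. coeff_g z * (t z * \<phi> z) + coeff_h z"
    and "W \<equiv> lin_frac \<Theta> (Fin \<phi>)"
  shows "W = Infty \<and> (\<forall>z\<in>upper_half_plane. D z = 0) \<or>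
      (\<exists>f. W = Fin f \<and> (\<exists>z\<in>upper_half_plane. D z \<noteq> 0) \<and>
        (\<forall>z\<in>upper_half_plane. D z \<noteq> 0 \<longrightarrow> f z = of_real (w i) + t z * (N z / D z)))"
proof -
  have t: "t z \<noteq> 0" if "z \<in> upper_half_plane" for z
    using that by (auto simp: upper_half_plane_def)
  have D: "D z = t z * (\<Theta> z $ 2 $ 1 * \<phi> z + \<Theta> z $ 2 $ 2)" if "z \<in> upper_half_plane" for z
    using Theta_node[of z] that unfolding D_def by (simp add: upper_half_plane_def distrib_left mult_ac)
  then have D0: "D z = 0 \<longleftrightarrow> \<Theta> z $ 2 $ 1 * \<phi> z + \<Theta> z $ 2 $ 2 = 0" if "z \<in> upper_half_plane" for z
    using t[OF that] that by simp
  have "(\<Theta> z $ 1 $ 1 * \<phi> z + \<Theta> z $ 1 $ 2) / (\<Theta> z $ 2 $ 1 * \<phi> z + \<Theta> z $ 2 $ 2)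
      = of_real (w i) + t z * (N z / D z)" if z: "z \<in> upper_half_plane" "D z \<noteq> 0" for z
  proof -
    note T = Theta_node[OF z(1)[unfolded upper_half_plane_def mem_Collect_eq]]
    define d where "d = \<Theta> z $ 2 $ 1 * \<phi> z + \<Theta> z $ 2 $ 2"
    have d: "d \<noteq> 0" "D z = t z * d" using D0 D z by (auto simp: d_def)
    have "\<Theta> z $ 1 $ 1 * \<phi> z + \<Theta> z $ 1 $ 2 = of_real (w i) * d + N z"
      unfolding d_def N_def T(4) unfolding T(1,2) by (simp add: algebra_simps)
    then show ?thesis
      using d t[OF z(1)] by (simp add: d_def[symmetric] add_divide_distrib)
  qed
  then show ?thesis
    using D0 unfolding W_def by (auto simp del: mult_eq_0_iff)
qed

lemma lin_frac_Infty:
  defines "W \<equiv> lin_frac \<Theta> Infty"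
  shows "W = Infty \<and> (\<forall>z\<in>upper_half_plane. coeff_g z = 0) \<or>
      (\<exists>f. W = Fin f \<and> (\<exists>z\<in>upper_half_plane. coeff_g z \<noteq> 0) \<and>
        (\<forall>z\<in>upper_half_plane. coeff_g z \<noteq> 0 \<longrightarrow> f z = of_real (w i) + t z * (coeff_a z / coeff_g z)))"
  using Theta_node unfolding W_def
  by (auto simp: upper_half_plane_def add_divide_distrib)

lemma boundary_Fin:
  assumes \<phi>: "nevanlinna \<phi>" and m: "m \<ge> 0"
    and lim: "((\<lambda>z. t z * \<phi> z) \<longlongrightarrow> of_real (- m)) (at_nontangential (x i))"
  shows "has_boundary_deriv (lin_frac \<Theta> (Fin \<phi>)) (x i) d \<and>
      has_boundary_value (lin_frac \<Theta> (Fin \<phi>)) (x i) (Fin (of_real (w i)))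
    \<longleftrightarrow> (c i)\<^sup>2 + p * m \<noteq> 0 \<and> d = of_real (\<gamma> i - m / ((c i)\<^sup>2 + p * m))"
proof -
  define N0 where "N0 = - (1 - \<gamma> i * p) / c i * - m + - \<gamma> i * c i"
  define D0 where "D0 = p / c i * - m + - c i"
  have hol: "(\<lambda>z. t z * \<phi> z) holomorphic_on upper_half_plane"
    using \<phi> by (auto simp: nevanlinna_def intro!: holomorphic_intros)
  have lims: "((\<lambda>z. coeff_a z * (t z * \<phi> z) + coeff_b z) \<longlongrightarrow> of_real N0) (at_nontangential (x i))"
    "((\<lambda>z. coeff_g z * (t z * \<phi> z) + coeff_h z) \<longlongrightarrow> of_real D0) (at_nontangential (x i))"
    unfolding N0_def D0_def of_real_add[of "_ * _"] of_real_mult[of _ "- m"]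
    by (intro tendsto_intros coeff_lim lim)+
  have D0: "D0 = - ((c i)\<^sup>2 + p * m) / c i"
    using c_nonzero by (simp add: D0_def field_simps power2_eq_square)
  \<comment> \<open>This relation both excludes a common zero of \<open>N0\<close> and
    \<open>D0\<close> and yields the value of the derivative.\<close>
  have N0: "N0 = \<gamma> i * D0 + m / c i"
    using c_nonzero by (simp add: D0_def N0_def field_simps)
  have "N0 \<noteq> 0 \<or> D0 \<noteq> 0"
    using c_nonzero N0 by (auto simp: D0)
  then have "has_boundary_deriv (lin_frac \<Theta> (Fin \<phi>)) (x i) d \<and>
      has_boundary_value (lin_frac \<Theta> (Fin \<phi>)) (x i) (Fin (of_real (w i)))
    \<longleftrightarrow> complex_of_real D0 \<noteq> 0 \<and> d = of_real N0 / of_real D0"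
    using holomorphic_coeff hol
    by (intro boundary_quotient[OF _ _ lims _ lin_frac_Fin[OF \<phi>]]) (auto intro!: holomorphic_intros)
  moreover have "N0 / D0 = \<gamma> i - m / ((c i)\<^sup>2 + p * m)" if "D0 \<noteq> 0"
  proof -
    have "(c i)\<^sup>2 + p * m \<noteq> 0" using that D0 by auto
    then have "m / c i / D0 = - (m / ((c i)\<^sup>2 + p * m))"
      using c_nonzero unfolding D0 by (simp add: divide_simps) (simp add: algebra_simps)
    then show ?thesis
      unfolding N0 add_divide_distrib using that by simp
  qed
  moreover have "D0 \<noteq> 0 \<longleftrightarrow> (c i)\<^sup>2 + p * m \<noteq> 0"
    using c_nonzero by (auto simp: D0 add_eq_0_iff)
  ultimately show ?thesis
    unfolding of_real_divide[symmetric] of_real_eq_0_iff by (cases "D0 = 0") auto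
qed

text \<open>Here \<open>coeff_a\<close> and \<open>coeff_g\<close> play the roles of N and D; when p
  = 0 the former still has the nonzero limit -1/c_i.\<close>

lemma boundary_Infty:
  "has_boundary_deriv (lin_frac \<Theta> Infty) (x i) d \<and>
      has_boundary_value (lin_frac \<Theta> Infty) (x i) (Fin (of_real (w i)))
    \<longleftrightarrow> p \<noteq> 0 \<and> d = of_real (\<gamma> i - 1 / p)"
proof -
  have ND: "complex_of_real (- (1 - \<gamma> i * p) / c i) \<noteq> 0 \<or> complex_of_real (p / c i) \<noteq> 0"
    unfolding of_real_eq_0_iff using c_nonzero by auto
  have "- (1 - \<gamma> i * p) / c i / (p / c i) = \<gamma> i - 1 / p" if "p \<noteq> 0"
    using that c_nonzero by (simp add: field_simps)
  moreover have "p / c i \<noteq> 0 \<longleftrightarrow> p \<noteq> 0"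
    using c_nonzero by simp
  ultimately show ?thesis
    unfolding boundary_quotient[OF holomorphic_coeff(1,3) coeff_lim(1,3) ND lin_frac_Infty]
      of_real_divide[symmetric] of_real_eq_0_iff by (cases "p = 0") simp_all
qed

section \<open>The degenerate case c^2 + p m = 0\<close>

lemma partial_fraction_diff:
  assumes "Im z \<noteq> 0"
  shows "partial_fraction u z
    = partial_fraction u (of_real (x i)) - t z * partial_fraction (\<lambda>k. u k / (x i - x k)) z"
proof -
  have "of_real (u k) / (z - of_real (x k)) = of_real (u k) / (of_real (x i) - of_real (x k))
      - t z * (of_real (u k / (x i - x k)) / (z - of_real (x k)))" if "k \<in> - {i}" for k
  proof -
    define a b where "a = z - complex_of_real (x k)" and "b = complex_of_real (x i) - of_real (x k)"
    have "a \<noteq> 0" "b \<noteq> 0" "t z = a - b"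
      using assms that inj_x[of i k] by (auto simp: a_def b_def)
    then show ?thesis
      unfolding of_real_divide of_real_diff a_def[symmetric] b_def[symmetric] \<open>t z = a - b\<close>
      by (simp add: field_simps)
  qed
  then show ?thesis
    unfolding partial_fraction_def sum_distrib_left sum_subtractf[symmetric]
    by (intro sum.cong refl) auto
qed

lemma coeff_g_expand: "Im z \<noteq> 0 \<Longrightarrow> coeff_g z = of_real (p / c i) + t z * coeff_s z"
  using partial_fraction_diff[of z "\<lambda>k. E $ k * e k"] coeff_g_node
  by (simp add: coeff_g_def coeff_s_def)

lemma real_like_partial_fraction: "real_like (x i) (partial_fraction u)"
proof -
  have "real_like (x i) (\<lambda>z. \<Sum>k\<in>-{i}. of_real (u k) * (1 / (z - of_real (x k))))"
    using inj_x by (intro real_like_sum real_like_mult real_like_const real_like_inverse_node) auto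
  then show ?thesis by (simp add: partial_fraction_def[abs_def])
qed

text \<open>Substituting t \<phi> = t g - m, where g = \<phi> + m/t has no point mass, turns the
  constant term of D into \<open>coeff_h - m * coeff_g\<close>, which vanishes at the node. So D
  acquires a factor t that cancels the t in w - w_i = t N / D, and
  \<open>moebius_kernel_at_top\<close> applies to g.\<close>

lemma boundary_kernel_infinite_Fin:
  assumes \<phi>: "nevanlinna \<phi>"
    and lim: "((\<lambda>z. t z * \<phi> z) \<longlongrightarrow> of_real (- m)) (at_nontangential (x i))"
    and f1: "nevanlinna (\<lambda>z. \<phi> z + of_real m / t z)"
    and inf: "\<And>\<epsilon>. \<epsilon> > 0 \<Longrightarrow> \<exists>z\<in>upper_half_plane.
       Im (\<phi> z + of_real m / t z) * (cmod (t z))\<^sup>2 < \<epsilon> * Im z"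
    and m: "(c i)\<^sup>2 + p * m = 0"
    and W: "lin_frac \<Theta> (Fin \<phi>) = Fin f"
    and f: "(f \<longlongrightarrow> of_real (w i)) (at_nontangential (x i))"
  shows "boundary_kernel_infinite (Fin f) (x i)"
proof -
  define F where "F = at_nontangential (x i)"
  define g where "g = (\<lambda>z. \<phi> z + of_real m / t z)"
  define N where "N = (\<lambda>z. coeff_a z * (t z * \<phi> z) + coeff_b z)"
  define D where "D = (\<lambda>z. coeff_g z * (t z * \<phi> z) + coeff_h z)"
  define \<alpha> where "\<alpha> = (\<lambda>z. t z * coeff_a z)"
  define \<beta> where "\<beta> = (\<lambda>z. coeff_b z - of_real m * coeff_a z)"
  define \<delta> where "\<delta> = (\<lambda>z. of_real 1 - partial_fraction (\<lambda>k. E $ k * c k) z - of_real m * coeff_s z)"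
  have pm: "p * m = - (c i)\<^sup>2" using m by simp
  have m0: "m \<noteq> 0" using pm c_nonzero by auto
  have tg: "t z * \<phi> z = t z * g z - of_real m" if "Im z \<noteq> 0" for z
    using that by (auto simp: g_def distrib_left)
  have N_eq: "N z = \<alpha> z * g z + \<beta> z" if "Im z \<noteq> 0" for z
    unfolding N_def tg[OF that] \<alpha>_def \<beta>_def by (simp add: algebra_simps)
  have D_eq: "D z = t z * (coeff_g z * g z + \<delta> z)" if "Im z \<noteq> 0" for z
  proof -
    have "m * (p / c i) = - c i"
      using pm c_nonzero by (simp add: field_simps power2_eq_square)
    then have "complex_of_real m * of_real (p / c i) = - of_real (c i)"
      by (metis of_real_minus of_real_mult)
    then have "of_real m * coeff_g z = - of_real (c i) + of_real m * (t z * coeff_s z)"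
      unfolding coeff_g_expand[OF that] by (simp add: distrib_left)
    then have "coeff_h z - of_real m * coeff_g z = t z * \<delta> z"
      unfolding coeff_h_def \<delta>_def by (simp add: algebra_simps)
    then show ?thesis
      unfolding D_def tg[OF that] by (simp add: algebra_simps)
  qed
  have hol: "(\<lambda>z. t z * \<phi> z) holomorphic_on upper_half_plane"
    using \<phi> by (auto simp: nevanlinna_def intro!: holomorphic_intros)
  have N_hol: "N holomorphic_on upper_half_plane" and D_hol: "D holomorphic_on upper_half_plane"
    unfolding N_def D_def using hol holomorphic_coeff by (auto intro!: holomorphic_intros)
  define b0 where "b0 = - \<gamma> i * c i - m * (- (1 - \<gamma> i * p) / c i)"
  have b0: "b0 = m / c i"
  proof -
    have "m * (1 - \<gamma> i * p) = m - \<gamma> i * (p * m)" by (simp add: algebra_simps)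
    then show ?thesis
      unfolding pm b0_def using c_nonzero by (simp add: field_simps power2_eq_square)
  qed
  have "(N \<longlongrightarrow> of_real (- (1 - \<gamma> i * p) / c i) * of_real (- m) + of_real (- \<gamma> i * c i)) F"
    unfolding N_def F_def by (intro tendsto_intros coeff_lim lim)
  also have "of_real (- (1 - \<gamma> i * p) / c i) * of_real (- m) + of_real (- \<gamma> i * c i) = complex_of_real b0"
    by (simp add: b0_def algebra_simps diff_divide_distrib)
  finally have N_lim: "(N \<longlongrightarrow> of_real b0) F" .
  have b0_0: "complex_of_real b0 \<noteq> 0" using b0 m0 c_nonzero by simp
  obtain nz: "\<exists>z\<in>upper_half_plane. D z \<noteq> 0"
    and f_eq: "\<And>z. z \<in> upper_half_plane \<Longrightarrow> D z \<noteq> 0 \<Longrightarrow> f z = of_real (w i) + t z * (N z / D z)"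
    using lin_frac_Fin[OF \<phi>] W unfolding N_def D_def by auto
  have D_ev: "\<forall>\<^sub>F z in F. D z \<noteq> 0"
    using eventually_denominator_nonzero[OF N_hol D_hol N_lim[unfolded F_def] b0_0 nz f_eq f]
    unfolding F_def by blast
  have Im_ev: "\<forall>\<^sub>F z in F. 0 < Im z"
    unfolding F_def by (rule eventually_at_nontangential_Im)
  have den: "\<forall>\<^sub>F z in F. coeff_g z * g z + \<delta> z \<noteq> 0"
    using D_ev Im_ev by eventually_elim (auto simp: D_eq)
  have quot: "\<forall>\<^sub>F z in F. f z - of_real (w i) = (\<alpha> z * g z + \<beta> z) / (coeff_g z * g z + \<delta> z)"
    using D_ev Im_ev
  proof eventually_elim
    case (elim z)
    then have "t z \<noteq> 0" by auto
    moreover have "f z - of_real (w i) = t z * (N z / D z)"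
      using f_eq[of z] elim by (simp add: upper_half_plane_def)
    ultimately show ?case
      using elim by (simp add: N_eq D_eq)
  qed
  have "filterlim (\<lambda>z. Im ((\<alpha> z * g z + \<beta> z) / (coeff_g z * g z + \<delta> z)) / Im z) at_top F"
  proof (rule moebius_kernel_at_top)
    show "nevanlinna g" unfolding g_def by (rule f1)
    show "\<exists>z\<in>upper_half_plane. Im (g z) * (cmod (t z))\<^sup>2 < \<epsilon> * Im z" if "\<epsilon> > 0" for \<epsilon>
      unfolding g_def by (rule inf[OF that])
    show "F = at_nontangential (x i)" by (rule F_def)
    have a: "real_like (x i) coeff_a"
      unfolding coeff_a_def[abs_def] by (rule real_like_partial_fraction)
    show "real_like (x i) \<alpha>"
      unfolding \<alpha>_def by (intro real_like_mult real_like_diff real_like_ident real_like_const a)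
    show "real_like (x i) \<beta>"
      unfolding \<beta>_def coeff_b_def of_real_minus[symmetric]
      by (intro real_like_mult real_like_diff real_like_const a real_like_partial_fraction)
    show "real_like (x i) coeff_g"
      unfolding coeff_g_def[abs_def] by (rule real_like_partial_fraction)
    show "real_like (x i) \<delta>"
      unfolding \<delta>_def coeff_s_def
      by (intro real_like_mult real_like_diff real_like_const real_like_uminus real_like_partial_fraction)
    have "(\<alpha> \<longlongrightarrow> 0 * of_real (- (1 - \<gamma> i * p) / c i)) F"
      unfolding \<alpha>_def F_def by (intro tendsto_mult coeff_lim tendsto_at_nontangential_minus)
    then show "(\<alpha> \<longlongrightarrow> 0) F" by simp
    have "(\<beta> \<longlongrightarrow> of_real (- \<gamma> i * c i) - of_real m * of_real (- (1 - \<gamma> i * p) / c i)) F"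
      unfolding \<beta>_def F_def by (intro tendsto_intros coeff_lim)
    then show "(\<beta> \<longlongrightarrow> of_real b0) F"
      unfolding b0_def by simp
    show "(coeff_g \<longlongrightarrow> of_real (p / c i)) F"
      unfolding F_def by (rule coeff_lim)
    have "isCont \<delta> (of_real (x i))"
      unfolding \<delta>_def coeff_s_def by (intro continuous_intros isCont_partial_fraction)
    then show "(\<delta> \<longlongrightarrow> \<delta> (of_real (x i))) F"
      unfolding F_def by (rule nontangential_isCont) simp
    \<comment> \<open>The product equals -1, because p m = - c_i^2.\<close>
    have "b0 * (p / c i) = p * m / (c i)\<^sup>2"
      by (simp add: b0 power2_eq_square)
    then show "b0 * (p / c i) < 0"
      using c_nonzero by (simp add: pm)
    show "((\<lambda>z. \<alpha> z * g z + \<beta> z) \<longlongrightarrow> of_real b0) F"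
      by (rule Lim_transform_eventually[OF N_lim]) (use Im_ev in \<open>auto elim!: eventually_mono simp: N_eq\<close>)
    have "((\<lambda>z. f z - of_real (w i)) \<longlongrightarrow> of_real (w i) - of_real (w i)) F"
      unfolding F_def by (intro tendsto_intros f)
    then have "((\<lambda>z. f z - of_real (w i)) \<longlongrightarrow> 0) F"
      by simp
    then show "((\<lambda>z. (\<alpha> z * g z + \<beta> z) / (coeff_g z * g z + \<delta> z)) \<longlongrightarrow> 0) F"
      using quot by (rule Lim_transform_eventually)
  qed (use b0_0 den in auto)
  moreover have "\<forall>\<^sub>F z in F. Im ((\<alpha> z * g z + \<beta> z) / (coeff_g z * g z + \<delta> z)) / Im z \<le> cmod (kernel f z z)"
    using quot Im_ev
  proof eventually_elim
    case (elim z)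
    have "kernel f z z = of_real (Im (f z) / Im z)"
      using elim unfolding kernel_def complex_diff_cnj by simp
    moreover have "Im ((\<alpha> z * g z + \<beta> z) / (coeff_g z * g z + \<delta> z)) = Im (f z)"
      unfolding elim(1)[symmetric] by simp
    ultimately show ?case by (simp only: norm_of_real abs_ge_self)
  qed
  ultimately show ?thesis
    unfolding boundary_kernel_infinite.simps F_def[symmetric] by (rule filterlim_at_top_mono)
qed

text \<open>For p = 0 \<open>coeff_g\<close> vanishes at the node, and cancelling t leaves w - w_i =
  \<open>coeff_a / coeff_s\<close>, whose numerator tends to -1/c_i. Its limit is finite and
  nonzero, or infinite, according to \<open>coeff_s\<close> at the node.\<close>

lemma boundary_value_Infty_neq:
  assumes p0: "p = 0"
  shows "\<exists>v. has_boundary_value (lin_frac \<Theta> Infty) (x i) v \<and> v \<noteq> Fin (of_real (w i))"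
  using lin_frac_Infty
proof (elim disjE conjE exE)
  assume "lin_frac \<Theta> Infty = Infty"
  then show ?thesis by (metis has_boundary_value.simps(3) with_infty.distinct(1))
next
  fix f assume W: "lin_frac \<Theta> Infty = Fin f" and nz: "\<exists>z\<in>upper_half_plane. coeff_g z \<noteq> 0"
    and f: "\<forall>z\<in>upper_half_plane. coeff_g z \<noteq> 0 \<longrightarrow> f z = of_real (w i) + t z * (coeff_a z / coeff_g z)"
  define F where "F = at_nontangential (x i)"
  \<comment> \<open>This domain contains the node, so zeros of \<open>coeff_s\<close> are isolated
    there; holomorphy on the half plane alone would not prevent them from accumulating at the
    boundary point.\<close>
  define S where "S = - complex_of_real ` x ` (- {i})"
  have S: "open S" "connected S" "of_real (x i) \<in> S" "upper_half_plane \<subseteq> S"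
  proof -
    have fin: "finite (complex_of_real ` x ` (- {i}))" by simp
    then show "open S"
      unfolding S_def by (intro open_Compl finite_imp_closed)
    show "connected S"
      unfolding S_def using fin by (intro path_connected_imp_connected path_connected_complement_countable
          countable_finite) auto
    show "of_real (x i) \<in> S" "upper_half_plane \<subseteq> S"
      using inj_x by (auto simp: S_def upper_half_plane_def)
  qed
  have g: "coeff_g z = t z * coeff_s z" if "z \<in> upper_half_plane" for z
    using coeff_g_expand[of z] that p0 by (simp add: upper_half_plane_def)
  have s_hol: "coeff_s holomorphic_on S"
    unfolding coeff_s_def[abs_def] S_def by (intro holomorphic_intros holomorphic_partial_fraction)
  obtain z0 where "z0 \<in> S" "coeff_s z0 \<noteq> 0"
    using nz g S(4) by auto
  then have "\<forall>\<^sub>F z in at (of_real (x i)). coeff_s z \<noteq> 0 \<and> z \<in> S"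
    by (rule non_zero_neighbour_alt[OF s_hol S(1-3)])
  then have s_ev: "\<forall>\<^sub>F z in F. coeff_s z \<noteq> 0"
    unfolding F_def by (intro filter_leD[OF at_nontangential_le]) (auto elim: eventually_mono)
  have f_ev: "\<forall>\<^sub>F z in F. of_real (w i) + coeff_a z / coeff_s z = f z"
    using s_ev eventually_at_nontangential_Im[of "x i", folded F_def]
  proof eventually_elim
    case (elim z)
    then have "z \<in> upper_half_plane" "t z \<noteq> 0" by (auto simp: upper_half_plane_def)
    then show ?case using elim f g by simp
  qed
  have a_lim: "(coeff_a \<longlongrightarrow> of_real (- 1 / c i)) F"
    using coeff_lim(1) by (simp add: F_def p0)
  have s_lim: "(coeff_s \<longlongrightarrow> coeff_s (of_real (x i))) F"
    unfolding F_def coeff_s_def[abs_def]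
    by (intro nontangential_isCont[OF _ refl] continuous_intros isCont_partial_fraction)
  show ?thesis
  proof (cases "coeff_s (of_real (x i)) = 0")
    case True
    then have "filterlim coeff_s (at 0) F"
      using s_lim s_ev by (simp add: filterlim_at)
    then have "filterlim (\<lambda>z. coeff_a z / coeff_s z) at_infinity F"
      using c_nonzero by (intro filterlim_divide_at_infinity[OF a_lim]) auto
    from tendsto_add_filterlim_at_infinity[OF tendsto_const this]
    have "filterlim f at_infinity F"
      by (rule filterlim_cong[OF refl refl f_ev, THEN iffD1])
    then show ?thesis
      unfolding W F_def by (intro exI[of _ Infty]) simp
  next
    case False
    have "((\<lambda>z. of_real (w i) + coeff_a z / coeff_s z)
        \<longlongrightarrow> of_real (w i) + of_real (- 1 / c i) / coeff_s (of_real (x i))) F"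
      by (intro tendsto_intros a_lim s_lim False)
    from Lim_transform_eventually[OF this f_ev] show ?thesis
      unfolding W F_def using False c_nonzero
      by (intro exI[of _ "Fin (of_real (w i) + of_real (- 1 / c i) / coeff_s (of_real (x i)))"]) simp
  qed
qed

end

section \<open>Case distinction on the parameter\<close>

theorem theorem2p4:
  fixes L :: "'n::finite set" and x w \<gamma> \<xi> :: "'n \<Rightarrow> real"
    and P :: "real^'n^'n" and \<phi> W :: "(complex \<Rightarrow> complex) with_infty" and i :: 'n
    and c e p :: real
  assumes data: "interpolation_data L x \<xi>"
    and P: "P = pick_matrix L x w \<gamma> \<xi>"
    and inv: "invertible P"
    and phi: "\<phi> \<in> nevanlinna_ext"
    and W: "W = lin_frac (Theta L x w \<gamma> \<xi>) \<phi>"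
    and i: "i \<in> L"
    and c: "c = (C_row L w \<xi> v* matrix_inv P) $ i"
    and e: "e = (E_row L v* matrix_inv P) $ i"
    and p: "p = matrix_inv P $ i $ i"
    and e0: "e = 0"
  shows
    "(has_boundary_deriv W (x i) (of_real (\<gamma> i)) \<and>
        has_boundary_value W (x i) (Fin (of_real (w i)))
      \<longleftrightarrow> cond1 \<phi> (x i) \<or> cond2 \<phi> (x i)) \<and>
     ((\<exists>d::real. has_boundary_deriv W (x i) (of_real d) \<and> d < \<gamma> i \<and>
        has_boundary_value W (x i) (Fin (of_real (w i))))
      \<longleftrightarrow> cond3 p c \<phi> (x i)) \<and>
     ((\<exists>d::real. has_boundary_deriv W (x i) (of_real d) \<and> \<gamma> i < d \<and>
        has_boundary_value W (x i) (Fin (of_real (w i))))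
      \<longleftrightarrow> cond4 p c \<phi> (x i)) \<and>
     (cond5 p c \<phi> (x i) \<longrightarrow>
        (\<nexists>v. has_boundary_value W (x i) v) \<or>
        (\<exists>v. has_boundary_value W (x i) v \<and> v \<noteq> Fin (of_real (w i))) \<or>
        (has_boundary_value W (x i) (Fin (of_real (w i))) \<and> boundary_kernel_infinite W (x i))) \<and>
     (cond6 p \<phi> (x i) \<longrightarrow>
        (\<exists>v. has_boundary_value W (x i) v \<and> v \<noteq> Fin (of_real (w i))))"
proof -
  interpret regular_node L x w \<gamma> \<xi> i
    using data inv i e e0 unfolding P by unfold_locales auto
  note c' = c[unfolded P] and p' = p[unfolded P]
  have c0: "c \<noteq> 0" unfolding c' by (rule c_nonzero)
  show ?thesis
  proof (cases \<phi>)
    case Infty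
    have *: "has_boundary_deriv W (x i) d \<and> has_boundary_value W (x i) (Fin (of_real (w i)))
        \<longleftrightarrow> p \<noteq> 0 \<and> d = of_real (\<gamma> i - 1 / p)" for d
      unfolding W Infty p' by (rule boundary_Infty)
    \<comment> \<open>\<open>R\<close> stands for either comparison of d with \<gamma>_i; the
      derivative is determined, so the existential reduces to its value.\<close>
    have ex: "(\<exists>d::real. has_boundary_deriv W (x i) (of_real d) \<and> R d \<and>
        has_boundary_value W (x i) (Fin (of_real (w i)))) \<longleftrightarrow> p \<noteq> 0 \<and> R (\<gamma> i - 1 / p)" for R
      using * by (metis of_real_eq_iff)
    have "(\<exists>v. has_boundary_value W (x i) v \<and> v \<noteq> Fin (of_real (w i)))" if "p = 0"
      unfolding W Infty using that p' by (intro boundary_value_Infty_neq) simp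
    then show ?thesis
      unfolding * ex using cond_Infty[OF c0] unfolding Infty by auto
  next
    case (Fin f)
    then have f: "nevanlinna f" using phi by (auto simp: nevanlinna_ext_def)
    obtain m where m: "m \<ge> 0" and f1: "nevanlinna (\<lambda>z. f z + of_real m / (z - of_real (x i)))"
      and inf: "\<And>\<epsilon>. \<epsilon> > 0 \<Longrightarrow> \<exists>z\<in>upper_half_plane.
        Im (f z + of_real m / (z - of_real (x i))) * (cmod (z - of_real (x i)))\<^sup>2 < \<epsilon> * Im z"
      using nevanlinna_point_mass[OF f] by blast
    \<comment> \<open>Removing the point mass leaves a function of residue 0, so t f tends to
      -m.\<close>
    have "((\<lambda>z. t z * (f z + of_real m / t z) - of_real m) \<longlongrightarrow> 0 - of_real m) (at_nontangential (x i))"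
      by (intro tendsto_diff nontangential_residue_zero f1 inf tendsto_const)
    moreover have "\<forall>\<^sub>F z in at_nontangential (x i). t z * (f z + of_real m / t z) - of_real m = t z * f z"
      using eventually_at_nontangential_Im[of "x i"] by eventually_elim (auto simp: distrib_left)
    ultimately have lim: "((\<lambda>z. t z * f z) \<longlongrightarrow> of_real (- m)) (at_nontangential (x i))"
      by (simp add: tendsto_cong)
    have *: "has_boundary_deriv W (x i) d \<and> has_boundary_value W (x i) (Fin (of_real (w i)))
        \<longleftrightarrow> c\<^sup>2 + p * m \<noteq> 0 \<and> d = of_real (\<gamma> i - m / (c\<^sup>2 + p * m))" for d
      unfolding W Fin p' c' by (rule boundary_Fin[OF f m lim])
    have ex: "(\<exists>d::real. has_boundary_deriv W (x i) (of_real d) \<and> R d \<and>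
        has_boundary_value W (x i) (Fin (of_real (w i))))
        \<longleftrightarrow> c\<^sup>2 + p * m \<noteq> 0 \<and> R (\<gamma> i - m / (c\<^sup>2 + p * m))" for R
      using * by (metis of_real_eq_iff)
    note cond = cond_Fin[OF lim m c0, folded Fin]
    have 5: "boundary_kernel_infinite W (x i)"
      if "cond5 p c \<phi> (x i)" and v: "has_boundary_value W (x i) (Fin (of_real (w i)))"
    proof (cases W)
      case Infty
      then show ?thesis using v by simp
    next
      case W': (Fin h)
      have "(h \<longlongrightarrow> of_real (w i)) (at_nontangential (x i))"
        using v unfolding W' by simp
      moreover have "c\<^sup>2 + p * m = 0" using cond(4) that by blast
      ultimately show ?thesis
        unfolding W' p' c'
        by (intro boundary_kernel_infinite_Fin[OF f lim f1 inf _ W'[unfolded W Fin]])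
    qed
    \<comment> \<open>What remains is the sign of the deviation - m / (c^2 + p m) from
      \<gamma>_i.\<close>
    have "c\<^sup>2 + p * m \<noteq> 0" if "m = 0" using that c0 by simp
    then have "c\<^sup>2 + p * m \<noteq> 0 \<and> complex_of_real (\<gamma> i) = of_real (\<gamma> i - m / (c\<^sup>2 + p * m)) \<longleftrightarrow> m = 0"
      unfolding of_real_eq_iff by auto
    moreover have "c\<^sup>2 + p * m \<noteq> 0 \<and> \<gamma> i - m / (c\<^sup>2 + p * m) < \<gamma> i \<longleftrightarrow> m > 0 \<and> c\<^sup>2 + p * m > 0"
      using m by (auto simp: zero_less_divide_iff)
    moreover have "c\<^sup>2 + p * m \<noteq> 0 \<and> \<gamma> i < \<gamma> i - m / (c\<^sup>2 + p * m) \<longleftrightarrow> m > 0 \<and> c\<^sup>2 + p * m < 0"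
      using m by (auto simp: divide_less_0_iff)
    ultimately show ?thesis
      unfolding * ex cond(1-3) using 5 cond(5) by blast
  qed
qed
end
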